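(* Plain version. Let $P,Q \subseteq \mathbb{N}$ be nonempty and disjoint. If the coding oracle associated to $(P,Q)$ is omniscient, then the promise problem $(P \times Q,\, Q \times P)$ is decidable. In other words, if $\mathbf{c}_{P,Q} = \boldsymbol{\omega}$ then $\mathbf{d}_{P\times Q,\, Q\times P} = \mathbf{0}$ (and this is an equivalence). Relativized version. Let $P, Q \subseteq \mathbb{N}$ be nonempty and disjoint, and let $\mathbf{a}$ be a T0 degree. If $\mathbf{c}_{P, Q} \vee \mathbf{a} = \boldsymbol{\omega}$ then $\mathbf{d}_{P \times Q,\, Q \times P} \leq \mathbf{a}$.
   Context: Oracles. A T0 oracle is a total function $\mathbb{N}\to\mathbb{N}$; a T1 oracle is a partial function from $\mathbb{N}$ to $\mathbb{N}$; a T2 oracle is a partial function from $\mathbb{N}$ to $\mathcal{P}(\mathbb{N})$; a T3 oracle is a total function $\mathbb{N}\to\mathcal{P}(\mathcal{P}(\mathbb{N}))$; a basic (T3) oracle is an element of $\mathcal{P}(\mathcal{P}(\mathbb{N}))$. Identifications: a T0 oracle is a T1 oracle that happens to be total; a T1 oracle $g$ is identified with the T2 oracle $n\mapsto\{g(n)\}$ (undefined where $g$ is); a T2 oracle $g$ is identified with the T3 oracle $n\mapsto\{g(n)\}$ if $g(n)$ is defined and $n\mapsto\varnothing$ otherwise; a basic oracle is identified with the corresponding constant T3 oracle. Reduction game of $f$ to $g$ (for T3 oracles $f,g$). Players Arthur and Nimue are allied against Merlin. The initial configuration is any $m\in\mathbb{N}$ together with a set $F\in f(m)$; Arthur sees only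 $m$, while Nimue and Merlin see both. Arthur, Nimue, Merlin then play in turn, repeatedly. At his turn Arthur either declares a final value $u\in\mathbb{N}$, ending the game (Arthur and Nimue win iff $u\in F$), or queries the oracle at some $n\in\mathbb{N}$. If $g(n)=\varnothing$, Arthur and Nimue lose immediately; otherwise Nimue chooses $G\in g(n)$ (seen by Merlin, not by Arthur). If $G=\varnothing$, Merlin loses immediately; otherwise Merlin chooses $v\in G$, which everyone sees, and it is Arthur's turn again. If the game never ends, Merlin wins. An Arthur strategy is a partial computable function taking $m$ and the finite sequence of Merlin's moves so far to Arthur's next move (if it is undefined or malformed, Arthur and Nimue lose); a Nimue strategy is an arbitrary function of the initial configuration and of all past moves of Arthur and Merlin. A pair of such strategies is winning if Arthur and Nimue win for every initial configuration and all moves of Merlin. One says $f$ is reducible to $g$ if a winning Arthur+Nimue strategy exists. This is a preorder; the T3 degrees $\mathscr{D}_{\mathrm{T3}}$ are the poset quotient, with order $\leq$. The T0, T1, T2, basic T3 degrees are the T3 degrees of T0, T1, T2, basic oracles, with the induced order; the T0 degrees are exactly the Turing degrees with their usual order. $\mathbf{0}$ is the degree of the constantly zero function, and $\boldsymbol{\omega}$ (the omniscient degree) is the degree of the basic oracle $\{\{n\}\mid n\in\mathbb{N}\}$ (equivalently of $\{\{0\},\{1\}\}$). $\vee$ is the binary join (supremum) in the T3 degrees, represented by $f\oplus g$ where $(f\oplus g)(2n)=f(n)$ and $(f\oplus g)(2n+1)=g(n)$. For $P,Q\subseteq\mathbb{N}$ nonempty and disjoint, the decoding oracle is the partial function equal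 to $0$ on $P$, $1$ on $Q$, undefined elsewhere, and $\mathbf{d}_{P,Q}$ is its T1 degree; the coding oracle is the basic oracle $\{P,Q\}$ and $\mathbf{c}_{P,Q}$ is its T3 degree. The promise problem $(P,Q)$ is decidable when $\mathbf{d}_{P,Q}=\mathbf{0}$, i.e. when some partial computable function is defined at least on $P\cup Q$ with value $0$ on $P$ and $1$ on $Q$. The coding oracle is omniscient when $\mathbf{c}_{P,Q}=\boldsymbol{\omega}$. Products are viewed as subsets of $\mathbb{N}$ through a fixed computable coding of pairs: $P\times Q=\{\langle p,q\rangle\mid p\in P,\,q\in Q\}$. *)

theory Defs
  imports Main "HOL-Library.Nat_Bijection"
begin

section \<open>Partial computable functions\<close>

text \<open>
  Partial computable functions are rendered as Kleene's \<open>\<mu>\<close>-recursive functions: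
  \<open>rec_eval r xs y\<close> means that the program \<open>r\<close> halts on the arguments \<open>xs\<close> with value \<open>y\<close>.
  Primitive recursion recurses on the first argument; in the step function the arguments are
  the predecessor, the previous value and the parameters, in this order. Minimisation searches
  over the first argument of its body, which must be defined and nonzero below the result.
\<close>

datatype recf = Zero | Succ | Proj nat | Comp recf "recf list" | PrimRec recf recf | Mu recf

inductive rec_eval :: "recf \<Rightarrow> nat list \<Rightarrow> nat \<Rightarrow> bool" where
  Zero: "rec_eval Zero xs 0"
| Succ: "rec_eval Succ [x] (Suc x)"
| Proj: "i < length xs \<Longrightarrow> rec_eval (Proj i) xs (xs ! i)"
| Comp: "list_all2 (\<lambda>s y. rec_eval s xs y) ss ys \<Longrightarrow> rec_eval r ys z
    \<Longrightarrow> rec_eval (Comp r ss) xs z"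
| PrimRec_0: "rec_eval r xs y \<Longrightarrow> rec_eval (PrimRec r s) (0 # xs) y"
| PrimRec_Suc: "rec_eval (PrimRec r s) (n # xs) y \<Longrightarrow> rec_eval s (n # y # xs) z
    \<Longrightarrow> rec_eval (PrimRec r s) (Suc n # xs) z"
| Mu: "rec_eval r (n # xs) 0 \<Longrightarrow> \<forall>i<n. \<exists>y. rec_eval r (i # xs) (Suc y)
    \<Longrightarrow> rec_eval (Mu r) xs n"

definition partial_computable :: "nat \<Rightarrow> (nat list \<Rightarrow> nat option) \<Rightarrow> bool" where
  "partial_computable k \<phi> \<longleftrightarrow>
     (\<exists>r. \<forall>xs. length xs = k \<longrightarrow> (\<forall>y. \<phi> xs = Some y \<longleftrightarrow> rec_eval r xs y))"


section \<open>Oracles\<close>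

type_synonym oracle0 = "nat \<Rightarrow> nat"
type_synonym oracle1 = "nat \<Rightarrow> nat option"
type_synonym oracle2 = "nat \<Rightarrow> nat set option"
type_synonym oracle3 = "nat \<Rightarrow> nat set set"
type_synonym basic_oracle = "nat set set"

definition T0_T1 :: "oracle0 \<Rightarrow> oracle1" where
  "T0_T1 g = (\<lambda>n. Some (g n))"

definition T1_T2 :: "oracle1 \<Rightarrow> oracle2" where
  "T1_T2 g = (\<lambda>n. map_option (\<lambda>x. {x}) (g n))"

definition T2_T3 :: "oracle2 \<Rightarrow> oracle3" where
  "T2_T3 g = (\<lambda>n. case g n of Some G \<Rightarrow> {G} | None \<Rightarrow> {})"

definition T1_T3 :: "oracle1 \<Rightarrow> oracle3" where
  "T1_T3 g = T2_T3 (T1_T2 g)"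

definition T0_T3 :: "oracle0 \<Rightarrow> oracle3" where
  "T0_T3 g = T1_T3 (T0_T1 g)"

definition basic_T3 :: "basic_oracle \<Rightarrow> oracle3" where
  "basic_T3 B = (\<lambda>_. B)"


section \<open>The reduction game\<close>

datatype arthur_move = Declare nat | Query nat

text \<open>This coding is bijective, so a defined value of Arthur's strategy is never malformed.\<close>

fun move_code :: "arthur_move \<Rightarrow> nat" where
  "move_code (Declare u) = 2 * u"
| "move_code (Query n) = 2 * n + 1"

text \<open>
  Arthur's strategy receives \<open>m\<close> and the list of Merlin's moves so far, oldest first. Nimue's
  receives the initial configuration \<open>m\<close>, \<open>F\<close>, the completed rounds (Arthur's query paired with
  Merlin's answer), oldest first, and Arthur's current query.
\<close>

type_synonym arthur_strategy = "nat \<Rightarrow> nat list \<Rightarrow> arthur_move option"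
type_synonym nimue_strategy = "nat \<Rightarrow> nat set \<Rightarrow> (nat \<times> nat) list \<Rightarrow> nat \<Rightarrow> nat set"

definition computable_arthur :: "arthur_strategy \<Rightarrow> bool" where
  "computable_arthur A \<longleftrightarrow>
     partial_computable 2 (\<lambda>xs. map_option move_code (A (xs ! 0) (list_decode (xs ! 1))))"

text \<open>
  \<open>reachable A N g m F h\<close>: in the reduction game to \<open>g\<close> from the initial configuration \<open>m\<close>, \<open>F\<close>,
  where Arthur and Nimue follow \<open>A\<close> and \<open>N\<close>, some moves of Merlin lead to the position with
  completed rounds \<open>h\<close> in which Arthur is to move.
\<close>

inductive reachable ::
  "arthur_strategy \<Rightarrow> nimue_strategy \<Rightarrow> oracle3 \<Rightarrow> nat \<Rightarrow> nat set \<Rightarrow> (nat \<times> nat) list \<Rightarrow> bool"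
  for A N g m F where
  start: "reachable A N g m F []"
| round: "reachable A N g m F h \<Longrightarrow> A m (map snd h) = Some (Query n) \<Longrightarrow> N m F h n \<in> g n
    \<Longrightarrow> v \<in> N m F h n \<Longrightarrow> reachable A N g m F (h @ [(n, v)])"

text \<open>
  Arthur and Nimue win against all moves of Merlin when they never lose in a round and no play
  goes on forever. In a round they do not lose if Arthur declares an element of \<open>F\<close>, or makes a
  query to which Nimue's answer \<open>G\<close> is legal; if then \<open>G = {}\<close>, Merlin has no move and loses.
\<close>

definition winning ::
  "arthur_strategy \<Rightarrow> nimue_strategy \<Rightarrow> oracle3 \<Rightarrow> oracle3 \<Rightarrow> bool" where
  "winning A N f g \<longleftrightarrow> (\<forall>m. \<forall>F \<in> f m.
     (\<forall>h. reachable A N g m F h \<longrightarrow>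
        (\<exists>u \<in> F. A m (map snd h) = Some (Declare u)) \<or>
        (\<exists>n. A m (map snd h) = Some (Query n) \<and> N m F h n \<in> g n)) \<and>
     \<not> (\<exists>p. \<forall>k. reachable A N g m F (map p [0..<k])))"

definition reducible :: "oracle3 \<Rightarrow> oracle3 \<Rightarrow> bool" (infix "\<preceq>" 50) where
  "f \<preceq> g \<longleftrightarrow> (\<exists>A N. computable_arthur A \<and> winning A N f g)"

text \<open>
  Degrees are handled through representatives: \<open>f \<approx> g\<close> says that \<open>f\<close> and \<open>g\<close> have the same T3
  degree, and \<open>f \<preceq> g\<close> that the degree of \<open>f\<close> is below that of \<open>g\<close>.
\<close>

definition same_degree :: "oracle3 \<Rightarrow> oracle3 \<Rightarrow> bool" (infix "\<approx>" 50) where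
  "f \<approx> g \<longleftrightarrow> f \<preceq> g \<and> g \<preceq> f"

definition join :: "oracle3 \<Rightarrow> oracle3 \<Rightarrow> oracle3" (infixl "\<oplus>" 65) where
  "f \<oplus> g = (\<lambda>k. if even k then f (k div 2) else g (k div 2))"

definition zero_oracle :: oracle0 where
  "zero_oracle = (\<lambda>_. 0)"

definition omniscient_oracle :: basic_oracle where
  "omniscient_oracle = {{n} | n. True}"


section \<open>Coding and decoding oracles\<close>

definition decoding_oracle :: "nat set \<Rightarrow> nat set \<Rightarrow> oracle1" where
  "decoding_oracle P Q = (\<lambda>n. if n \<in> P then Some 0 else if n \<in> Q then Some 1 else None)"

definition coding_oracle :: "nat set \<Rightarrow> nat set \<Rightarrow> basic_oracle" where
  "coding_oracle P Q = {P, Q}"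

definition promise_decidable :: "nat set \<Rightarrow> nat set \<Rightarrow> bool" where
  "promise_decidable P Q \<longleftrightarrow> (\<exists>\<phi>. partial_computable 1 (\<lambda>xs. \<phi> (xs ! 0)) \<and>
     (\<forall>n \<in> P. \<phi> n = Some 0) \<and> (\<forall>n \<in> Q. \<phi> n = Some 1))"

definition pair_set :: "nat set \<Rightarrow> nat set \<Rightarrow> nat set" where
  "pair_set P Q = {prod_encode (p, q) | p q. p \<in> P \<and> q \<in> Q}"

end

theory Submission
  imports Defs HOL.Filter
begin

text \<open>
  Suppose that Arthur and Nimue win the reduction game from \<open>\<omega>\<close> to the coding oracle \<open>{P, Q}\<close>
  joined with \<open>a\<close>. To tell whether \<open>(x, y)\<close> lies in \<open>P \<times> Q\<close> or in \<open>Q \<times> P\<close>, fix \<open>p \<in> P\<close> and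
  \<open>q \<in> Q\<close> once and for all. If \<open>(x, y) \<in> P \<times> Q\<close>, then \<open>{p, x} \<subseteq> P\<close> and \<open>{q, y} \<subseteq> Q\<close>, so Nimue can
  still force Arthur to declare \<open>0\<close> when Merlin is confined to \<open>{p, x}\<close> whenever she chooses \<open>P\<close> and
  to \<open>{q, y}\<close> whenever she chooses \<open>Q\<close>. All choices now being finite, the positions that arise
  form a finite set, a \<open>certificate\<close> for the value \<open>0\<close> (\<open>ex_certificate\<close>). If
  \<open>(x, y) \<in> Q \<times> P\<close>, there is in the same way a certificate for the value \<open>1\<close> and the sets
  \<open>{p, y}\<close> and \<open>{q, x}\<close>. The two certificates exclude each other: each of \<open>{p, x}\<close>, \<open>{q, y}\<close>
  meets each of \<open>{p, y}\<close>, \<open>{q, x}\<close>, so Merlin could always answer with a common element and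
  keep Arthur, who does not see Nimue's choices, on a single play on which he would have to
  declare both \<open>0\<close> and \<open>1\<close> (\<open>certificate_value_unique\<close>). Searching for
  either certificate therefore decides the promise problem.

  The search has to be effective. Arthur's strategy is a partial computable function, and certificates
  only mention positions at which it is defined, so it is run with a bound on its resources:
  \<open>approximates\<close> associates to every program a total recursive function of a stage and the arguments
  whose values are correct and eventually found; it is built by recursion on the program, so that no
  universal machine is involved (\<open>ex_approximates\<close>). In the game with oracle \<open>a\<close>, the new Arthur asks
  for \<open>a 0\<close>, \<open>a 1\<close>, \<open>\<dots>\<close> in turn, and after \<open>k\<close> answers checks the certificates with a code below
  \<open>k\<close> at stage \<open>k\<close>. This gives the relativized statement
  (\<open>decoding_reducible_if_coding_omniscient\<close>).

  For the equivalences, an Arthur who plays against a computable oracle can answer his own queries, so a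
  reduction of the decoding oracle to \<open>\<zero>\<close> yields a decision procedure
  (\<open>promise_decidable_if_reducible_zero\<close>). Conversely, a decision procedure for
  \<open>(P \<times> Q, Q \<times> P)\<close> lets Nimue transmit one bit with two queries, by choosing \<open>P\<close> then \<open>Q\<close>
  or \<open>Q\<close> then \<open>P\<close>, and hence any number in unary
  (\<open>coding_omniscient_if_promise_decidable\<close>).
\<close>

section \<open>Total recursive functions and decidable predicates\<close>

lemma rec_eval_Succ_iff: "rec_eval Succ xs y \<longleftrightarrow> (\<exists>x. xs = [x] \<and> y = Suc x)"
  by (subst rec_eval.simps) auto

lemma rec_eval_Proj_iff: "rec_eval (Proj i) xs y \<longleftrightarrow> i < length xs \<and> y = xs ! i"
  by (subst rec_eval.simps) auto

lemma rec_eval_Comp_iff: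
  "rec_eval (Comp r ss) xs z \<longleftrightarrow> (\<exists>ys. list_all2 (\<lambda>s y. rec_eval s xs y) ss ys \<and> rec_eval r ys z)"
  by (subst rec_eval.simps) auto

lemma rec_eval_PrimRec_Nil: "\<not> rec_eval (PrimRec r s) [] y"
  by (subst rec_eval.simps) auto

lemma rec_eval_PrimRec_0_iff: "rec_eval (PrimRec r s) (0 # xs) y \<longleftrightarrow> rec_eval r xs y"
  by (subst rec_eval.simps) auto

lemma rec_eval_PrimRec_Suc_iff:
  "rec_eval (PrimRec r s) (Suc n # xs) z \<longleftrightarrow>
     (\<exists>y. rec_eval (PrimRec r s) (n # xs) y \<and> rec_eval s (n # y # xs) z)"
  by (subst rec_eval.simps) auto

lemma rec_eval_Mu_iff:
  "rec_eval (Mu r) xs n \<longleftrightarrow>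
     rec_eval r (n # xs) 0 \<and> (\<forall>i<n. \<exists>y. rec_eval r (i # xs) (Suc y))"
  by (subst rec_eval.simps) auto

lemma rec_eval_functional:
  assumes "rec_eval r xs y" and "rec_eval r xs z"
  shows "y = z"
  using assms
proof (induction arbitrary: z rule: rec_eval.induct)
  case (Zero xs)
  then show ?case by (subst (asm) rec_eval.simps) auto
next
  case (Comp xs ss ys r w)
  obtain zs where zs: "list_all2 (\<lambda>s y. rec_eval s xs y) ss zs" "rec_eval r zs z"
    using Comp.prems by (auto simp: rec_eval_Comp_iff)
  have "ys = zs"
    using Comp.IH(1) zs(1) by (auto simp: list_all2_conv_all_nth intro: nth_equalityI)
  then show ?case using Comp.IH(2) zs(2) by blast
next
  case (Mu r n xs)
  have z: "rec_eval r (z # xs) 0" "\<forall>i<z. \<exists>y. rec_eval r (i # xs) (Suc y)"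
    using Mu.prems by (auto simp: rec_eval_Mu_iff)
  show ?case
  proof (cases n z rule: linorder_cases)
    case less
    then obtain y where "rec_eval r (n # xs) (Suc y)" using z(2) by blast
    then show ?thesis using Mu.IH(1) by blast
  next
    case greater
    then show ?thesis using Mu.IH(2) z(1) by blast
  qed simp
next
  case (PrimRec_Suc r s n xs y w)
  then show ?case unfolding rec_eval_PrimRec_Suc_iff by blast
qed (auto simp: rec_eval_Succ_iff rec_eval_Proj_iff rec_eval_PrimRec_0_iff)

definition recursive :: "nat \<Rightarrow> (nat list \<Rightarrow> nat) \<Rightarrow> bool" where
  "recursive k f \<longleftrightarrow> (\<exists>r. \<forall>xs. length xs = k \<longrightarrow> rec_eval r xs (f xs))"

definition decidable :: "nat \<Rightarrow> (nat list \<Rightarrow> bool) \<Rightarrow> bool" where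
  "decidable k P \<longleftrightarrow> recursive k (\<lambda>xs. of_bool (P xs))"

lemma recursiveI: "(\<And>xs. length xs = k \<Longrightarrow> rec_eval r xs (f xs)) \<Longrightarrow> recursive k f"
  by (auto simp: recursive_def)

lemma recursive_cong:
  assumes "recursive k f" and "\<And>xs. length xs = k \<Longrightarrow> f xs = g xs"
  shows "recursive k g"
  using assms by (auto simp: recursive_def)

lemma decidable_cong:
  assumes "decidable k P" and "\<And>xs. length xs = k \<Longrightarrow> P xs = R xs"
  shows "decidable k R"
  using assms by (auto simp: decidable_def intro: recursive_cong)

lemma recursive_nth: "i < k \<Longrightarrow> recursive k (\<lambda>xs. xs ! i)"
  by (rule recursiveI[where r = "Proj i"]) (simp add: rec_eval_Proj_iff)

lemma recursive_comp:
  assumes f: "recursive (length gs) f" and gs: "\<And>g. g \<in> set gs \<Longrightarrow> recursive k g"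
  shows "recursive k (\<lambda>xs. f (map (\<lambda>g. g xs) gs))"
proof -
  obtain rf where rf: "\<And>xs. length xs = length gs \<Longrightarrow> rec_eval rf xs (f xs)"
    using f by (auto simp: recursive_def)
  obtain R where R: "\<And>g xs. g \<in> set gs \<Longrightarrow> length xs = k \<Longrightarrow> rec_eval (R g) xs (g xs)"
    using gs unfolding recursive_def by metis
  show ?thesis
  proof (rule recursiveI)
    fix xs :: "nat list" assume "length xs = k"
    then show "rec_eval (Comp rf (map R gs)) xs (f (map (\<lambda>g. g xs) gs))"
      by (intro rec_eval.Comp) (auto simp: list_all2_conv_all_nth intro!: R rf)
  qed
qed

lemma recursive_Suc:
  assumes "recursive k f"
  shows "recursive k (\<lambda>xs. Suc (f xs))"
proof -
  have "recursive (length [f]) (\<lambda>ys. Suc (hd ys))"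
    by (rule recursiveI[where r = Succ]) (auto simp: rec_eval_Succ_iff length_Suc_conv)
  from recursive_comp[OF this] show ?thesis using assms by simp
qed

lemma recursive_const: "recursive k (\<lambda>xs. n)"
proof (induction n)
  case 0
  show ?case by (rule recursiveI[where r = recf.Zero]) (rule rec_eval.Zero)
next
  case (Suc n)
  then show ?case by (rule recursive_Suc)
qed

text \<open>
  Primitive recursion and minimisation put new arguments in front of the old ones; this substitution
  rule introduces, permutes and drops such leading arguments while leaving the others in place.
\<close>

lemma recursive_subst_prefix:
  assumes f: "recursive (length es + (k - d)) f" and es: "\<And>e. e \<in> set es \<Longrightarrow> recursive k e"
  shows "recursive k (\<lambda>xs. f (map (\<lambda>e. e xs) es @ drop d xs))"
proof -
  let ?gs = "es @ map (\<lambda>i xs. xs ! i) [d..<k]"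
  have "recursive k (\<lambda>xs. f (map (\<lambda>g. g xs) ?gs))"
    by (rule recursive_comp) (use f es in \<open>auto intro: recursive_nth\<close>)
  then show ?thesis
  proof (rule recursive_cong)
    fix xs :: "nat list" assume "length xs = k"
    then have "map (\<lambda>i. xs ! i) [d..<k] = drop d xs"
      by (intro nth_equalityI) auto
    then show "f (map (\<lambda>g. g xs) ?gs) = f (map (\<lambda>e. e xs) es @ drop d xs)"
      by (simp add: o_def)
  qed
qed

text \<open>
  Functions under a binder are handled with the bound variable as an extra first argument:
  in the rules below \<open>hd ys\<close> is the bound variable and \<open>tl ys\<close> the surrounding arguments.
\<close>

lemma recursive_tl:
  assumes "recursive k f"
  shows "recursive (Suc k) (\<lambda>ys. f (tl ys))"
  using recursive_subst_prefix[of "[]" "Suc k" 1 f] assms by (simp add: drop_Suc)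

lemma recursive_hd: "recursive (Suc k) hd"
  by (rule recursive_cong[OF recursive_nth[of 0]]) (auto simp: length_Suc_conv)

lemma recursive_rec_nat:
  assumes a: "recursive k a" and n: "recursive k n"
    and g: "recursive (Suc (Suc k)) (\<lambda>ys. g (hd ys) (hd (tl ys)) (tl (tl ys)))"
  shows "recursive k (\<lambda>xs. rec_nat (a xs) (\<lambda>i v. g i v xs) (n xs))"
proof -
  let ?h = "\<lambda>ys. rec_nat (a (tl ys)) (\<lambda>i v. g i v (tl ys)) (hd ys)"
  obtain ra where ra: "\<And>xs. length xs = k \<Longrightarrow> rec_eval ra xs (a xs)"
    using a by (auto simp: recursive_def)
  obtain rg where rg: "\<And>xs i v. length xs = k \<Longrightarrow> rec_eval rg (i # v # xs) (g i v xs)"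
    using g unfolding recursive_def by (metis length_Cons list.sel(1,3))
  have eval: "rec_eval (PrimRec ra rg) (m # xs) (rec_nat (a xs) (\<lambda>i v. g i v xs) m)"
    if "length xs = k" for m xs
    by (induction m) (auto intro: rec_eval.intros ra rg that)
  have "recursive (Suc k) ?h"
  proof (rule recursiveI)
    fix ys :: "nat list" assume "length ys = Suc k"
    then show "rec_eval (PrimRec ra rg) ys (?h ys)"
      using eval by (auto simp: length_Suc_conv)
  qed
  then show ?thesis
    using recursive_subst_prefix[of "[n]" k 0 ?h] n by simp
qed

lemma recursive_case_zero:
  assumes "recursive k a" and "recursive k b" and "recursive k c"
  shows "recursive k (\<lambda>xs. if a xs = 0 then b xs else c xs)"
proof -
  have "recursive k (\<lambda>xs. rec_nat (b xs) (\<lambda>_ _. c xs) (a xs))"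
    using assms by (intro recursive_rec_nat recursive_tl)
  moreover have eq: "rec_nat u (\<lambda>_ _. v) n = (if n = 0 then u else v)" for u v n :: nat
    by (cases n) auto
  ultimately show ?thesis by (simp only: eq)
qed

lemma decidable_zero:
  assumes "recursive k a"
  shows "decidable k (\<lambda>xs. a xs = 0)"
  unfolding decidable_def
  by (rule recursive_cong[OF recursive_case_zero[OF assms recursive_const[of k 1] recursive_const[of k 0]]]) simp

lemma recursive_if:
  assumes "decidable k P" and "recursive k a" and "recursive k b"
  shows "recursive k (\<lambda>xs. if P xs then a xs else b xs)"
  by (rule recursive_cong[OF recursive_case_zero[OF assms(1)[unfolded decidable_def] assms(3,2)]]) simp

lemma decidable_not:
  assumes "decidable k P"
  shows "decidable k (\<lambda>xs. \<not> P xs)"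
  unfolding decidable_def
  by (rule recursive_cong[OF recursive_if[OF assms recursive_const[of k 0] recursive_const[of k 1]]]) simp

lemma decidable_conj:
  assumes "decidable k P" and "decidable k R"
  shows "decidable k (\<lambda>xs. P xs \<and> R xs)"
  unfolding decidable_def
  by (rule recursive_cong[OF recursive_if[OF assms(1) assms(2)[unfolded decidable_def] recursive_const[of k 0]]]) simp

lemma decidable_disj:
  assumes "decidable k P" and "decidable k R"
  shows "decidable k (\<lambda>xs. P xs \<or> R xs)"
  using decidable_not[OF decidable_conj[OF decidable_not[OF assms(1)] decidable_not[OF assms(2)]]] by simp

lemma decidable_imp:
  assumes "decidable k P" and "decidable k R"
  shows "decidable k (\<lambda>xs. P xs \<longrightarrow> R xs)"
  by (rule decidable_cong[OF decidable_disj[OF decidable_not[OF assms(1)] assms(2)]]) blast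

lemma recursive_add:
  assumes "recursive k a" and "recursive k b"
  shows "recursive k (\<lambda>xs. a xs + b xs)"
proof -
  have "recursive k (\<lambda>xs. rec_nat (b xs) (\<lambda>_ v. Suc v) (a xs))"
    using assms by (intro recursive_rec_nat recursive_Suc recursive_tl[OF recursive_hd])
  moreover have eq: "rec_nat c (\<lambda>_ v. Suc v) n = n + c" for c n :: nat
    by (induction n) auto
  ultimately show ?thesis by (simp only: eq)
qed

lemma recursive_mult:
  assumes "recursive k a" and "recursive k b"
  shows "recursive k (\<lambda>xs. a xs * b xs)"
proof -
  have "recursive k (\<lambda>xs. rec_nat 0 (\<lambda>_ v. b xs + v) (a xs))"
    using assms by (intro recursive_rec_nat recursive_add recursive_const
        recursive_tl[OF recursive_hd] recursive_tl[OF recursive_tl])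
  moreover have eq: "rec_nat 0 (\<lambda>_ v. c + v) n = n * c" for c n :: nat
    by (induction n) auto
  ultimately show ?thesis by (simp only: eq)
qed

lemma recursive_power:
  assumes "recursive k a" and "recursive k b"
  shows "recursive k (\<lambda>xs. a xs ^ b xs)"
proof -
  have "recursive k (\<lambda>xs. rec_nat 1 (\<lambda>_ v. a xs * v) (b xs))"
    using assms by (intro recursive_rec_nat recursive_mult recursive_const
        recursive_tl[OF recursive_hd] recursive_tl[OF recursive_tl])
  moreover have eq: "rec_nat 1 (\<lambda>_ v. c * v) n = c ^ n" for c n :: nat
    by (induction n) auto
  ultimately show ?thesis by (simp only: eq)
qed

lemma recursive_diff:
  assumes "recursive k a" and "recursive k b"
  shows "recursive k (\<lambda>xs. a xs - b xs)"
proof -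
  have pred: "recursive j (\<lambda>xs. c xs - 1)" if "recursive j c" for j c
  proof -
    have "recursive j (\<lambda>xs. rec_nat 0 (\<lambda>i _. i) (c xs))"
      using that by (intro recursive_rec_nat recursive_const recursive_hd)
    then show ?thesis
    proof (rule recursive_cong)
      show "rec_nat 0 (\<lambda>i _. i) (c xs) = c xs - 1" for xs by (cases "c xs") auto
    qed
  qed
  have "recursive k (\<lambda>xs. rec_nat (a xs) (\<lambda>_ v. v - 1) (b xs))"
    using assms by (intro recursive_rec_nat pred recursive_tl[OF recursive_hd])
  moreover have eq: "rec_nat c (\<lambda>_ v. v - 1) n = c - n" for c n :: nat
    by (induction n) auto
  ultimately show ?thesis by (simp only: eq)
qed

lemma decidable_eq:
  assumes "recursive k a" and "recursive k b"
  shows "decidable k (\<lambda>xs. a xs = b xs)"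
  by (rule decidable_cong[OF decidable_zero[OF recursive_add[OF recursive_diff[OF assms] recursive_diff[OF assms(2,1)]]]])
    auto

lemma decidable_less:
  assumes "recursive k a" and "recursive k b"
  shows "decidable k (\<lambda>xs. a xs < b xs)"
  by (rule decidable_cong[OF decidable_not[OF decidable_zero[OF recursive_diff[OF assms(2,1)]]]]) auto

lemma recursive_Least:
  assumes P: "decidable (Suc k) (\<lambda>ys. P (hd ys) (tl ys))"
    and ex: "\<And>xs. length xs = k \<Longrightarrow> \<exists>n. P n xs"
  shows "recursive k (\<lambda>xs. LEAST n. P n xs)"
proof -
  obtain r where "\<And>ys. length ys = Suc k \<Longrightarrow> rec_eval r ys (of_bool (\<not> P (hd ys) (tl ys)))"
    using decidable_not[OF P] by (auto simp: decidable_def recursive_def)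
  then have r: "\<And>n xs. length xs = k \<Longrightarrow> rec_eval r (n # xs) (of_bool (\<not> P n xs))"
    by (metis length_Cons list.sel(1,3))
  show ?thesis
  proof (rule recursiveI)
    fix xs :: "nat list" assume len: "length xs = k"
    let ?n = "LEAST n. P n xs"
    have "P ?n xs" using ex[OF len] by (rule LeastI_ex)
    then have "rec_eval r (?n # xs) 0" using r[OF len, of ?n] by simp
    moreover have "\<exists>y. rec_eval r (i # xs) (Suc y)" if "i < ?n" for i
      using r[OF len, of i] not_less_Least[OF that] by auto
    ultimately show "rec_eval (Mu r) xs ?n" by (auto intro: rec_eval.Mu)
  qed
qed

text \<open>
  The value is found by unbounded search. Unpairing and appending to a coded list, which are not
  defined by primitive recursion on their arguments, have graphs that are easy to decide.
\<close>

lemma recursive_graph: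
  assumes "decidable (Suc k) (\<lambda>ys. G (hd ys) (tl ys))"
    and "\<And>n xs. length xs = k \<Longrightarrow> G n xs \<longleftrightarrow> n = f xs"
  shows "recursive k f"
  by (rule recursive_cong[OF recursive_Least[OF assms(1)]]) (auto simp: assms(2) intro: Least_equality)

text \<open>
  The search for a witness is made total by letting it stop at the bound as well.
\<close>

lemma decidable_bex:
  assumes P: "decidable (Suc k) (\<lambda>ys. P (hd ys) (tl ys))" and b: "recursive k b"
  shows "decidable k (\<lambda>xs. \<exists>i<b xs. P i xs)"
proof -
  let ?l = "\<lambda>xs. LEAST n. n = b xs \<or> P n xs"
  have "recursive k ?l"
    by (intro recursive_Least decidable_disj decidable_eq recursive_hd recursive_tl P b) auto
  then have "decidable k (\<lambda>xs. ?l xs < b xs)"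
    by (rule decidable_less[OF _ b])
  then show ?thesis
  proof (rule decidable_cong)
    fix xs :: "nat list"
    have "?l xs = b xs \<or> P (?l xs) xs" by (rule LeastI[where k = "b xs"]) simp
    moreover have "?l xs \<le> i" if "P i xs" for i using that by (intro Least_le) simp
    ultimately show "?l xs < b xs \<longleftrightarrow> (\<exists>i<b xs. P i xs)" by force
  qed
qed

lemma decidable_ball:
  assumes P: "decidable (Suc k) (\<lambda>ys. P (hd ys) (tl ys))" and b: "recursive k b"
  shows "decidable k (\<lambda>xs. \<forall>i<b xs. P i xs)"
  using decidable_not[OF decidable_bex[OF decidable_not[OF P] b]] by simp

lemma decidable_list_all:
  assumes "\<And>s. s \<in> set ss \<Longrightarrow> decidable k (T s)"
  shows "decidable k (\<lambda>xs. \<forall>s\<in>set ss. T s xs)"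
  using assms
proof (induction ss)
  case Nil
  show ?case using decidable_zero[OF recursive_const[of k 0]] by simp
next
  case (Cons s ss)
  then show ?case using decidable_conj[of k "T s" "\<lambda>xs. \<forall>s\<in>set ss. T s xs"] by simp
qed

lemma recursive_apply3:
  "recursive 3 f \<Longrightarrow> recursive k a \<Longrightarrow> recursive k b \<Longrightarrow> recursive k c \<Longrightarrow> recursive k (\<lambda>xs. f [a xs, b xs, c xs])"
  using recursive_comp[of "[a, b, c]" f k] by (auto simp: numeral_3_eq_3)


lemma recursive_div:
  assumes "recursive k a" and "recursive k b"
  shows "recursive k (\<lambda>xs. a xs div b xs)"
proof (rule recursive_cong)
  show "recursive k (\<lambda>xs. LEAST q. b xs = 0 \<or> a xs < b xs * Suc q)"
  proof (rule recursive_Least)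
    fix xs
    have "b xs = 0 \<or> a xs < b xs * Suc (a xs div b xs)"
      using dividend_less_times_div[of "b xs" "a xs"] by auto
    then show "\<exists>q. b xs = 0 \<or> a xs < b xs * Suc q" ..
  qed (intro decidable_disj decidable_eq decidable_less recursive_mult recursive_Suc
      recursive_const recursive_hd recursive_tl assms)
  show "(LEAST q. b xs = 0 \<or> a xs < b xs * Suc q) = a xs div b xs" for xs
  proof (rule Least_equality)
    show "b xs = 0 \<or> a xs < b xs * Suc (a xs div b xs)"
      using dividend_less_times_div[of "b xs" "a xs"] by auto
    show "a xs div b xs \<le> q" if "b xs = 0 \<or> a xs < b xs * Suc q" for q
      using that by (metis div_by_0 le0 less_Suc_eq_le less_mult_imp_div_less mult.commute)
  qed
qed

lemma recursive_mod:
  assumes "recursive k a" and "recursive k b"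
  shows "recursive k (\<lambda>xs. a xs mod b xs)"
  by (rule recursive_cong[OF recursive_diff[OF assms(1) recursive_mult[OF recursive_div[OF assms] assms(2)]]])
    (simp add: minus_div_mult_eq_mod)

lemma recursive_prod_encode:
  assumes "recursive k a" and "recursive k b"
  shows "recursive k (\<lambda>xs. prod_encode (a xs, b xs))"
  unfolding prod_encode_def triangle_def prod.case
  by (intro recursive_add recursive_div recursive_mult recursive_Suc recursive_const assms)

lemma recursive_prod_decode:
  assumes "recursive k a"
  shows "recursive k (\<lambda>xs. fst (prod_decode (a xs)))" and "recursive k (\<lambda>xs. snd (prod_decode (a xs)))"
proof -
  have le: "i < Suc n" "j < Suc n" if "n = prod_encode (i, j)" for n i j
    using le_prod_encode_1[of i j] le_prod_encode_2[of j i] that by auto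
  show "recursive k (\<lambda>xs. fst (prod_decode (a xs)))"
  proof (rule recursive_graph)
    show "decidable (Suc k) (\<lambda>ys. \<exists>j<Suc (a (tl ys)). a (tl ys) = prod_encode (hd ys, j))"
      by (intro decidable_bex decidable_eq recursive_Suc recursive_prod_encode
          recursive_tl[OF recursive_hd] recursive_hd
          recursive_tl[OF recursive_tl] recursive_tl assms)
    show "(\<exists>j<Suc (a xs). a xs = prod_encode (i, j)) \<longleftrightarrow> i = fst (prod_decode (a xs))" for i xs
      by (metis fst_conv le(2) prod.collapse prod_decode_inverse prod_encode_inverse)
  qed
  show "recursive k (\<lambda>xs. snd (prod_decode (a xs)))"
  proof (rule recursive_graph)
    show "decidable (Suc k) (\<lambda>ys. \<exists>i<Suc (a (tl ys)). a (tl ys) = prod_encode (i, hd ys))"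
      by (intro decidable_bex decidable_eq recursive_Suc recursive_prod_encode
          recursive_tl[OF recursive_hd] recursive_hd
          recursive_tl[OF recursive_tl] recursive_tl assms)
    show "(\<exists>i<Suc (a xs). a xs = prod_encode (i, j)) \<longleftrightarrow> j = snd (prod_decode (a xs))" for j xs
      by (metis snd_conv le(1) prod.collapse prod_decode_inverse prod_encode_inverse)
  qed
qed

lemma decidable_mem_set_decode:
  assumes "recursive k a" and "recursive k b"
  shows "decidable k (\<lambda>xs. a xs \<in> set_decode (b xs))"
proof (rule decidable_cong)
  show "decidable k (\<lambda>xs. (b xs div 2 ^ a xs) mod 2 = 1)"
    by (intro decidable_eq recursive_mod recursive_div recursive_power recursive_const assms)
qed (simp only: set_decode_def mem_Collect_eq odd_iff_mod_2_eq_one)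


section \<open>Coded lists\<close>

definition code_tl :: "nat \<Rightarrow> nat" where
  "code_tl c = snd (prod_decode (c - 1))"

definition code_length :: "nat \<Rightarrow> nat" where
  "code_length c = length (list_decode c)"

definition code_nth :: "nat \<Rightarrow> nat \<Rightarrow> nat" where
  "code_nth c i = (if i < code_length c then list_decode c ! i else 0)"

definition code_snoc :: "nat \<Rightarrow> nat \<Rightarrow> nat" where
  "code_snoc c v = list_encode (list_decode c @ [v])"

definition code_drop :: "nat \<Rightarrow> nat \<Rightarrow> nat" where
  "code_drop n c = rec_nat c (\<lambda>_ v. code_tl v) n"

lemma list_decode_code_tl: "list_decode (code_tl c) = tl (list_decode c)"
proof (cases c)
  case 0
  have "prod_encode (0, 0) = 0" by (simp add: prod_encode_def)
  then have "prod_decode 0 = (0, 0)" by (metis prod_encode_inverse)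
  then show ?thesis using 0 by (simp add: code_tl_def)
next
  case (Suc n)
  then show ?thesis by (simp add: code_tl_def split: prod.splits)
qed

lemma list_decode_code_drop: "list_decode (code_drop n c) = drop n (list_decode c)"
  unfolding code_drop_def by (induction n) (auto simp: list_decode_code_tl drop_Suc drop_tl)

lemma code_drop_eq_0_iff: "code_drop n c = 0 \<longleftrightarrow> code_length c \<le> n"
  by (metis code_length_def drop_eq_Nil list_decode.simps(1) list_decode_code_drop
      list_decode_inverse list_encode.simps(1))

lemma recursive_code_tl: "recursive k a \<Longrightarrow> recursive k (\<lambda>xs. code_tl (a xs))"
  unfolding code_tl_def by (intro recursive_prod_decode recursive_diff recursive_const)

lemma recursive_code_drop:
  assumes "recursive k a" and "recursive k b"
  shows "recursive k (\<lambda>xs. code_drop (a xs) (b xs))"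
  unfolding code_drop_def by (intro recursive_rec_nat recursive_code_tl recursive_tl[OF recursive_hd] assms)

lemma recursive_code_length:
  assumes "recursive k a"
  shows "recursive k (\<lambda>xs. code_length (a xs))"
proof (rule recursive_cong)
  show "recursive k (\<lambda>xs. LEAST n. code_drop n (a xs) = 0)"
    by (intro recursive_Least decidable_zero recursive_code_drop recursive_hd recursive_tl assms)
      (auto simp: code_drop_eq_0_iff)
  show "(LEAST n. code_drop n (a xs) = 0) = code_length (a xs)" for xs
    by (auto simp: code_drop_eq_0_iff intro: Least_equality)
qed

lemma recursive_code_nth:
  assumes "recursive k a" and "recursive k b"
  shows "recursive k (\<lambda>xs. code_nth (a xs) (b xs))"
proof (rule recursive_cong)
  show "recursive k (\<lambda>xs. if b xs < code_length (a xs)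
      then fst (prod_decode (code_drop (b xs) (a xs) - 1)) else 0)"
    by (intro recursive_if decidable_less recursive_code_length recursive_prod_decode
        recursive_diff recursive_code_drop
        recursive_const assms)
  have "fst (prod_decode (code_drop i c - 1)) = list_decode c ! i" if i: "i < code_length c" for i c
  proof -
    obtain n where n: "code_drop i c = Suc n"
      using i code_drop_eq_0_iff[of i c] by (cases "code_drop i c") auto
    have "list_decode (Suc n) = drop i (list_decode c)"
      using list_decode_code_drop[of i c] n by simp
    then have "hd (list_decode (Suc n)) = list_decode c ! i"
      using i by (simp only: code_length_def hd_drop_conv_nth)
    then show ?thesis using n by (simp split: prod.splits)
  qed
  then show "(if b xs < code_length (a xs)
      then fst (prod_decode (code_drop (b xs) (a xs) - 1)) else 0) = code_nth (a xs) (b xs)" for xs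
    by (simp add: code_nth_def)
qed

lemma recursive_code_snoc:
  assumes "recursive k a" and "recursive k b"
  shows "recursive k (\<lambda>xs. code_snoc (a xs) (b xs))"
proof (rule recursive_graph)
  show "decidable (Suc k) (\<lambda>ys. code_length (hd ys) = Suc (code_length (a (tl ys))) \<and>
      (\<forall>i<code_length (a (tl ys)). code_nth (hd ys) i = code_nth (a (tl ys)) i) \<and>
      code_nth (hd ys) (code_length (a (tl ys))) = b (tl ys))"
    by (intro decidable_conj decidable_ball decidable_eq recursive_Suc recursive_code_length
        recursive_code_nth
        recursive_tl[OF recursive_hd] recursive_hd recursive_tl[OF recursive_tl] recursive_tl assms)
  show "(code_length c = Suc (code_length (a xs)) \<and>
      (\<forall>i<code_length (a xs). code_nth c i = code_nth (a xs) i) \<and>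
      code_nth c (code_length (a xs)) = b xs) \<longleftrightarrow> c = code_snoc (a xs) (b xs)" (is "?L \<longleftrightarrow> ?R")
    for c xs
  proof
    assume L: ?L
    then have "list_decode c = list_decode (a xs) @ [b xs]"
      by (intro nth_equalityI) (auto simp: code_length_def code_nth_def nth_append less_Suc_eq)
    then show ?R by (metis code_snoc_def list_decode_inverse)
  next
    assume ?R
    then have "list_decode c = list_decode (a xs) @ [b xs]" by (simp add: code_snoc_def)
    then show ?L by (simp add: code_length_def code_nth_def nth_append)
  qed
qed

section \<open>Stagewise approximation of partial recursive functions\<close>

text \<open>
  A value \<open>Suc y\<close> of \<open>R\<close> at stage \<open>s\<close> reports the result \<open>y\<close>; the value \<open>0\<close> means that no result is
  known yet. Reports are correct at every stage, and a result that exists is reported at all sufficiently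
  large stages, so that finitely many results are all available at some common stage.
\<close>

definition approximates :: "nat \<Rightarrow> recf \<Rightarrow> (nat list \<Rightarrow> nat) \<Rightarrow> bool" where
  "approximates k r R \<longleftrightarrow> recursive (Suc k) R \<and>
     (\<forall>xs s y. length xs = k \<longrightarrow> R (s # xs) = Suc y \<longrightarrow> rec_eval r xs y) \<and>
     (\<forall>xs y. length xs = k \<longrightarrow> rec_eval r xs y \<longrightarrow> (\<forall>\<^sub>F s in sequentially. R (s # xs) = Suc y))"

lemma approximatesI:
  assumes "recursive (Suc k) R"
    and "\<And>xs s y. length xs = k \<Longrightarrow> R (s # xs) = Suc y \<Longrightarrow> rec_eval r xs y"
    and "\<And>xs y. length xs = k \<Longrightarrow> rec_eval r xs y \<Longrightarrow> \<forall>\<^sub>F s in sequentially. R (s # xs) = Suc y"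
  shows "approximates k r R"
  using assms by (auto simp: approximates_def)

lemma approximatesD:
  assumes "approximates k r R"
  shows approximates_recursive: "recursive (Suc k) R"
    and approximates_sound: "length xs = k \<Longrightarrow> R (s # xs) = Suc y \<Longrightarrow> rec_eval r xs y"
    and approximates_eventually:
      "length xs = k \<Longrightarrow> rec_eval r xs y \<Longrightarrow> \<forall>\<^sub>F s in sequentially. R (s # xs) = Suc y"
  using assms by (auto simp: approximates_def)

lemma approximates_total:
  assumes "recursive k f" and "\<And>xs y. length xs = k \<Longrightarrow> rec_eval r xs y \<longleftrightarrow> y = f xs"
  shows "approximates k r (\<lambda>ys. Suc (f (tl ys)))"
  by (rule approximatesI) (use assms in \<open>auto intro: recursive_Suc recursive_tl\<close>)

lemma approximates_undefined:
  assumes "\<And>xs y. length xs = k \<Longrightarrow> \<not> rec_eval r xs y"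
  shows "approximates k r (\<lambda>ys. 0)"
  by (rule approximatesI) (use assms in \<open>auto intro: recursive_const\<close>)

lemma approximates_Comp:
  assumes R: "approximates (length ss) r R"
    and T: "\<And>s. s \<in> set ss \<Longrightarrow> approximates k s (T s)"
  shows "approximates k (Comp r ss) (\<lambda>ys. if \<forall>s\<in>set ss. T s ys \<noteq> 0
      then R (hd ys # map (\<lambda>s. T s ys - 1) ss) else 0)" (is "approximates k _ ?F")
proof (rule approximatesI)
  have "recursive (Suc k) (\<lambda>ys. R (map (\<lambda>g. g ys) (hd # map (\<lambda>s ys. T s ys - 1) ss)))"
    using approximates_recursive[OF R] approximates_recursive[OF T]
    by (intro recursive_comp) (auto intro: recursive_hd intro!: recursive_diff recursive_const)
  then have "recursive (Suc k) (\<lambda>ys. R (hd ys # map (\<lambda>s. T s ys - 1) ss))"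
    by (simp add: o_def)
  then show "recursive (Suc k) ?F"
    using approximates_recursive[OF T]
    by (intro recursive_if decidable_list_all decidable_not decidable_zero recursive_const) auto
next
  fix xs s y
  assume len: "length xs = k" and F: "?F (s # xs) = Suc y"
  let ?ys = "map (\<lambda>t. T t (s # xs) - 1) ss"
  have pos: "\<forall>t\<in>set ss. T t (s # xs) \<noteq> 0" and R': "R (s # ?ys) = Suc y"
    using F by (auto split: if_splits)
  have "rec_eval (ss ! i) xs (T (ss ! i) (s # xs) - 1)" if "i < length ss" for i
    using that pos approximates_sound[OF T len, of "ss ! i" s] by simp
  then have "list_all2 (\<lambda>t y. rec_eval t xs y) ss ?ys"
    by (simp add: list_all2_conv_all_nth)
  moreover have "rec_eval r ?ys y"
    using approximates_sound[OF R _ R'] by simp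
  ultimately show "rec_eval (Comp r ss) xs y" by (rule rec_eval.Comp)
next
  fix xs y
  assume len: "length xs = k" and "rec_eval (Comp r ss) xs y"
  then obtain zs where zs: "list_all2 (\<lambda>t y. rec_eval t xs y) ss zs" "rec_eval r zs y"
    by (auto simp: rec_eval_Comp_iff)
  have lenz: "length zs = length ss" using zs(1) by (simp add: list_all2_lengthD)
  have "\<forall>\<^sub>F s in sequentially. \<forall>i\<in>{..<length ss}. T (ss ! i) (s # xs) = Suc (zs ! i)"
    using zs(1) by (intro eventually_ball_finite ballI approximates_eventually[OF T len])
      (auto simp: list_all2_conv_all_nth)
  moreover have "\<forall>\<^sub>F s in sequentially. R (s # zs) = Suc y"
    by (rule approximates_eventually[OF R lenz zs(2)])
  ultimately show "\<forall>\<^sub>F s in sequentially. ?F (s # xs) = Suc y"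
  proof eventually_elim
    case (elim s)
    have "map (\<lambda>t. T t (s # xs) - 1) ss = zs"
      using elim(1) lenz by (intro nth_equalityI) auto
    moreover have "\<forall>t\<in>set ss. T t (s # xs) \<noteq> 0"
      using elim(1) by (auto simp: in_set_conv_nth)
    ultimately show ?case using elim(2) by simp
  qed
qed

lemma approximates_PrimRec:
  assumes R: "approximates k r R" and T: "approximates (Suc (Suc k)) t T"
  shows "approximates (Suc k) (PrimRec r t) (\<lambda>ys. rec_nat (R (hd ys # drop 2 ys))
      (\<lambda>i v. if v = 0 then 0 else T (hd ys # i # (v - 1) # drop 2 ys)) (ys ! 1))"
    (is "approximates _ _ ?F")
proof (rule approximatesI)
  have R': "recursive (Suc (Suc k)) (\<lambda>ys. R (hd ys # drop 2 ys))"
    using recursive_subst_prefix[of "[hd]" "Suc (Suc k)" 2 R] approximates_recursive[OF R]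
    by (simp add: recursive_hd)
  let ?e = "[\<lambda>zs. hd (tl (tl zs)), hd, \<lambda>zs. hd (tl zs) - 1] :: (nat list \<Rightarrow> nat) list"
  have "recursive (Suc (Suc (Suc (Suc k)))) (\<lambda>zs. T (map (\<lambda>e. e zs) ?e @ drop 4 zs))"
    by (rule recursive_subst_prefix)
      (use approximates_recursive[OF T] in \<open>auto intro: recursive_hd recursive_tl[OF recursive_tl[OF recursive_hd]]
        recursive_diff[OF recursive_tl[OF recursive_hd] recursive_const]\<close>)
  then have T': "recursive (Suc (Suc (Suc (Suc k))))
      (\<lambda>zs. T (hd (tl (tl zs)) # hd zs # (hd (tl zs) - 1) # drop 2 (tl (tl zs))))"
    by (simp add: drop_Suc numeral_eq_Suc)
  show "recursive (Suc (Suc k)) ?F"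
    by (intro recursive_rec_nat recursive_if decidable_zero recursive_const R' T'
        recursive_tl[OF recursive_hd] recursive_nth) simp
next
  define G where "G s zs = rec_nat (R (s # zs)) (\<lambda>i v. if v = 0 then 0 else T (s # i # (v - 1) # zs))"
    for s zs
  have FG: "?F (s # n # zs) = G s zs n" for s n zs
    unfolding G_def by (simp add: numeral_2_eq_2 cong: if_cong)
  have *: "rec_eval (PrimRec r t) (n # zs) y" if "length zs = k" "G s zs n = Suc y" for n zs s y
    using that(2)
  proof (induction n arbitrary: y)
    case 0
    then show ?case
      using approximates_sound[OF R that(1)] by (auto simp: G_def intro: rec_eval.PrimRec_0)
  next
    case (Suc n)
    then obtain v where v: "G s zs n = Suc v" "T (s # n # v # zs) = Suc y"
      by (cases "G s zs n") (auto simp: G_def)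
    have "rec_eval t (n # v # zs) y"
      using approximates_sound[OF T _ v(2)] that(1) by simp
    with Suc.IH[OF v(1)] show ?case by (rule rec_eval.PrimRec_Suc)
  qed
  show "rec_eval (PrimRec r t) xs y" if "length xs = Suc k" "?F (s # xs) = Suc y" for xs s y
    using that *[of "tl xs" s "hd xs" y] FG by (cases xs) auto
  have *: "\<forall>\<^sub>F s in sequentially. G s zs n = Suc y"
    if "length zs = k" "rec_eval (PrimRec r t) (n # zs) y" for n zs y
    using that(2)
  proof (induction n arbitrary: y)
    case 0
    then show ?case
      using approximates_eventually[OF R that(1)] by (simp add: G_def rec_eval_PrimRec_0_iff)
  next
    case (Suc n)
    then obtain v where v: "rec_eval (PrimRec r t) (n # zs) v" "rec_eval t (n # v # zs) y"
      by (auto simp: rec_eval_PrimRec_Suc_iff)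
    have "\<forall>\<^sub>F s in sequentially. T (s # n # v # zs) = Suc y"
      using approximates_eventually[OF T _ v(2)] that(1) by simp
    with Suc.IH[OF v(1)] show ?case by eventually_elim (simp add: G_def)
  qed
  show "\<forall>\<^sub>F s in sequentially. ?F (s # xs) = Suc y"
    if "length xs = Suc k" "rec_eval (PrimRec r t) xs y" for xs y
    using that *[of "tl xs" "hd xs" y] FG by (cases xs) auto
qed

text \<open>
  At stage \<open>s\<close> the search looks only below \<open>s\<close>. It stops at the first argument for which the
  approximation of the body reports \<open>0\<close> or nothing at all, since past an unknown value the result of
  the minimisation would not be certain.
\<close>

lemma approximates_Mu:
  assumes R: "approximates (Suc k) r R"
  shows "approximates k (Mu r) (\<lambda>ys. let n = LEAST n. n = hd ys \<or> R (hd ys # n # tl ys) < 2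
      in if n \<noteq> hd ys \<and> R (hd ys # n # tl ys) = 1 then Suc n else 0)" (is "approximates _ _ ?F")
proof (rule approximatesI)
  let ?l = "\<lambda>ys. LEAST n. n = hd ys \<or> R (hd ys # n # tl ys) < 2"
  have *: "recursive j (\<lambda>zs. R (a zs # b zs # drop d zs))"
    if "recursive j a" "recursive j b" "j - d = k" for j a b d
    using recursive_subst_prefix[of "[a, b]" j d R] approximates_recursive[OF R] that by auto
  have "recursive (Suc (Suc k)) (\<lambda>zs. R (hd (tl zs) # hd zs # drop 2 zs))"
    by (intro * recursive_hd recursive_tl[OF recursive_hd]) simp
  then have "recursive (Suc (Suc k)) (\<lambda>zs. R (hd (tl zs) # hd zs # tl (tl zs)))"
    by (simp add: drop_Suc numeral_eq_Suc)
  then have l: "recursive (Suc k) ?l"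
    by (intro recursive_Least decidable_disj decidable_eq decidable_less recursive_const
        recursive_hd recursive_tl[OF recursive_hd]) auto
  have "recursive (Suc k) (\<lambda>ys. R (hd ys # ?l ys # drop 1 ys))"
    by (intro * recursive_hd l) simp
  then have "recursive (Suc k) (\<lambda>ys. R (hd ys # ?l ys # tl ys))"
    by (simp add: drop_Suc)
  then show "recursive (Suc k) ?F"
    unfolding Let_def
    by (intro recursive_if decidable_conj decidable_not decidable_eq recursive_Suc recursive_const
        recursive_hd l)
next
  fix xs s y
  assume len: "length xs = k" and F: "?F (s # xs) = Suc y"
  let ?P = "\<lambda>n. n = s \<or> R (s # n # xs) < 2"
  have y: "y = (LEAST n. ?P n)" and R1: "R (s # y # xs) = Suc 0"
    using F by (auto simp: Let_def split: if_splits)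
  show "rec_eval (Mu r) xs y"
  proof (rule rec_eval.Mu)
    show "rec_eval r (y # xs) 0" using approximates_sound[OF R _ R1] len by simp
    show "\<forall>i<y. \<exists>v. rec_eval r (i # xs) (Suc v)"
    proof (intro allI impI)
      fix i assume "i < y"
      then have "\<not> ?P i" using not_less_Least y by blast
      then have "R (s # i # xs) = Suc (Suc (R (s # i # xs) - 2))" by arith
      then have "rec_eval r (i # xs) (Suc (R (s # i # xs) - 2))"
        using approximates_sound[OF R] len by simp
      then show "\<exists>v. rec_eval r (i # xs) (Suc v)" ..
    qed
  qed
next
  fix xs y
  assume len: "length xs = k" and "rec_eval (Mu r) xs y"
  then obtain v where y: "rec_eval r (y # xs) 0"
    and v: "\<And>i. i < y \<Longrightarrow> rec_eval r (i # xs) (Suc (v i))"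
    unfolding rec_eval_Mu_iff by metis
  have "\<forall>\<^sub>F s in sequentially. R (s # y # xs) = Suc 0"
    using approximates_eventually[OF R _ y] len by simp
  moreover have "\<forall>\<^sub>F s in sequentially. \<forall>i\<in>{..<y}. R (s # i # xs) = Suc (Suc (v i))"
    by (intro eventually_ball_finite ballI approximates_eventually[OF R]) (use len v in auto)
  moreover have "\<forall>\<^sub>F s in sequentially. y < s" by (rule eventually_gt_at_top)
  ultimately show "\<forall>\<^sub>F s in sequentially. ?F (s # xs) = Suc y"
  proof eventually_elim
    case (elim s)
    have "(LEAST n. n = s \<or> R (s # n # xs) < 2) = y"
    proof (rule Least_equality)
      show "y \<le> i" if "i = s \<or> R (s # i # xs) < 2" for i
        using that elim by (cases "i < y") auto
    qed (use elim in simp)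
    then show ?case using elim by simp
  qed
qed

text \<open>
  Programs that are undefined for reasons of arity, such as \<open>Succ\<close> on two arguments, are
  approximated by the function that never reports a result.
\<close>

lemma ex_approximates: "\<exists>R. approximates k r R"
proof (induction r arbitrary: k)
  case Zero
  show ?case
    by (rule exI, rule approximates_total[OF recursive_const[of k 0]]) (subst rec_eval.simps, auto)
next
  case Succ
  show ?case
  proof (cases "k = 1")
    case True
    then show ?thesis
      by (intro exI[where x = "\<lambda>ys. Suc (Suc (tl ys ! 0))"] approximates_total
          recursive_Suc recursive_nth)
        (auto simp: rec_eval_Succ_iff length_Suc_conv)
  next
    case False
    then show ?thesis
      by (intro exI[where x = "\<lambda>_. 0"] approximates_undefined) (auto simp: rec_eval_Succ_iff)
  qed
next
  case (Proj i)
  show ?case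
  proof (cases "i < k")
    case True
    then show ?thesis
      by (intro exI[where x = "\<lambda>ys. Suc (tl ys ! i)"] approximates_total recursive_nth)
        (auto simp: rec_eval_Proj_iff)
  next
    case False
    then show ?thesis
      by (intro exI[where x = "\<lambda>_. 0"] approximates_undefined) (auto simp: rec_eval_Proj_iff)
  qed
next
  case (Comp r ss)
  obtain R where R: "approximates (length ss) r R" using Comp.IH(1) by blast
  have "\<forall>s\<in>set ss. \<exists>T. approximates k s T" using Comp.IH(2) by blast
  then obtain T where "\<forall>s\<in>set ss. approximates k s (T s)" using bchoice by force
  then show ?case using approximates_Comp[OF R] by blast
next
  case (PrimRec r t)
  show ?case
  proof (cases k)
    case 0
    then show ?thesis
      by (intro exI[where x = "\<lambda>_. 0"] approximates_undefined) (auto simp: rec_eval_PrimRec_Nil)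
  next
    case (Suc j)
    obtain R T where "approximates j r R" "approximates (Suc (Suc j)) t T"
      using PrimRec.IH by blast
    then show ?thesis unfolding Suc by (blast intro: approximates_PrimRec)
  qed
next
  case (Mu r)
  then show ?case by (blast intro: approximates_Mu)
qed

section \<open>Certificates in the reduction game\<close>

definition computes_strategy :: "recf \<Rightarrow> arthur_strategy \<Rightarrow> bool" where
  "computes_strategy r A \<longleftrightarrow>
     (\<forall>m l y. rec_eval r [m, list_encode l] y \<longleftrightarrow> (\<exists>d. A m l = Some d \<and> y = move_code d))"

lemma computable_arthur_iff: "computable_arthur A \<longleftrightarrow> (\<exists>r. computes_strategy r A)"
proof -
  have "(\<forall>xs. length xs = 2 \<longrightarrow> (\<forall>y. map_option move_code (A (xs ! 0) (list_decode (xs ! 1))) = Some y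
      \<longleftrightarrow> rec_eval r xs y)) \<longleftrightarrow> computes_strategy r A" (is "?L \<longleftrightarrow> ?R") for r
  proof
    assume L: ?L
    show ?R unfolding computes_strategy_def
    proof (intro allI)
      fix m l y
      show "rec_eval r [m, list_encode l] y \<longleftrightarrow> (\<exists>d. A m l = Some d \<and> y = move_code d)"
        using L[rule_format, of "[m, list_encode l]" y] by auto
    qed
  next
    assume R: ?R
    show ?L
    proof (intro allI impI)
      fix xs :: "nat list" and y assume "length xs = 2"
      then obtain m c where xs: "xs = [m, c]"
        by (auto simp: numeral_2_eq_2 length_Suc_conv)
      show "map_option move_code (A (xs ! 0) (list_decode (xs ! 1))) = Some y \<longleftrightarrow> rec_eval r xs y"
        using R[unfolded computes_strategy_def, rule_format, of m "list_decode c" y] xs by auto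
    qed
  qed
  then show ?thesis by (simp add: computable_arthur_def partial_computable_def)
qed

lemma computable_arthur_total:
  assumes f: "recursive 2 f" and B: "\<And>m l. f [m, list_encode l] = move_code (B m l)"
  shows "computable_arthur (\<lambda>m l. Some (B m l))"
proof -
  obtain r where r: "\<And>xs. length xs = 2 \<Longrightarrow> rec_eval r xs (f xs)"
    using f by (auto simp: recursive_def)
  have "rec_eval r [m, list_encode l] y \<longleftrightarrow> y = move_code (B m l)" for m l y
    using r[of "[m, list_encode l]"] rec_eval_functional B[of m l] by (metis length_Cons list.size(3) Suc_1 One_nat_def)
  then show ?thesis by (auto simp: computable_arthur_iff computes_strategy_def)
qed

lemma move_code_eq_even: "move_code d = 2 * u \<longleftrightarrow> d = Declare u"
proof (cases d)
  case (Query n)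
  then show ?thesis using even_Suc[of "2 * n"] by (metis Suc_eq_plus1 dvd_triv_left
      move_code.simps(2) arthur_move.distinct(1))
qed simp

lemma move_code_eq_odd: "move_code d = 2 * n + 1 \<longleftrightarrow> d = Query n"
proof (cases d)
  case (Declare u)
  then show ?thesis using even_Suc[of "2 * n"] by (metis Suc_eq_plus1 dvd_triv_left
      move_code.simps(1) arthur_move.distinct(1))
qed simp

lemma T0_T3_apply: "T0_T3 a n = {{a n}}"
  by (simp add: T0_T3_def T1_T3_def T2_T3_def T1_T2_def T0_T1_def)

lemma mem_T1_T3_decoding_oracle:
  "F \<in> T1_T3 (decoding_oracle P Q) m \<longleftrightarrow> m \<in> P \<and> F = {0} \<or> m \<notin> P \<and> m \<in> Q \<and> F = {1}"
  by (auto simp: decoding_oracle_def T1_T3_def T2_T3_def T1_T2_def)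

text \<open>
  In a game to a join \<open>f \<oplus> g\<close> with \<open>g\<close> the oracle \<open>a\<close>, even queries go to \<open>f\<close> and odd ones to
  \<open>a\<close>. The family \<open>\<C>\<close> takes the place of the sets that Nimue may choose in \<open>f\<close>. A
  position is the list of Merlin's answers, which is all that Arthur sees; it is justified by \<open>L\<close> if
  Arthur declares the intended value, or if after his query some choice of Nimue
  leads only to positions in \<open>L\<close>.
\<close>

definition justified ::
  "(nat list \<Rightarrow> arthur_move option) \<Rightarrow> nat \<Rightarrow> nat set set \<Rightarrow> oracle0 \<Rightarrow> nat list set \<Rightarrow> nat list \<Rightarrow> bool"
  where
  "justified A b \<C> a L h \<longleftrightarrow>
     A h = Some (Declare b) \<or>
     (\<exists>n. A h = Some (Query (2 * n))) \<and> (\<exists>C\<in>\<C>. \<forall>v\<in>C. h @ [v] \<in> L) \<or>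
     (\<exists>n. A h = Some (Query (2 * n + 1)) \<and> h @ [a n] \<in> L)"

text \<open>
  When \<open>L\<close> is finite, this is a finite winning strategy for Nimue in the game restricted to \<open>\<C>\<close>:
  positions get longer along a play, so every play that stays in \<open>L\<close> ends, and Arthur then
  declares \<open>b\<close> unless Merlin has no answer left.
\<close>

definition certificate ::
  "(nat list \<Rightarrow> arthur_move option) \<Rightarrow> nat \<Rightarrow> nat set set \<Rightarrow> oracle0 \<Rightarrow> nat list set \<Rightarrow> bool" where
  "certificate A b \<C> a L \<longleftrightarrow> [] \<in> L \<and> (\<forall>h\<in>L. justified A b \<C> a L h)"

lemma justified_mono: "justified A b \<C> a L h \<Longrightarrow> L \<subseteq> L' \<Longrightarrow> justified A b \<C> a L' h"
  unfolding justified_def by blast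

lemma justified_cases:
  assumes "justified A b \<C> a L h"
  obtains "A h = Some (Declare b)"
    | n C where "A h = Some (Query (2 * n))" "C \<in> \<C>" "\<And>v. v \<in> C \<Longrightarrow> h @ [v] \<in> L"
    | n where "A h = Some (Query (2 * n + 1))" "h @ [a n] \<in> L"
  using assms unfolding justified_def by blast

text \<open>
  Let Merlin answer every query with an element common to the choices made by the two Nimues. Arthur
  cannot tell the two games apart, and the play stays in both certificates as long as neither value
  is declared. If the values differed it could never stop, since a declaration would have to be of
  both; but \<open>L\<close> contains no infinite play.
\<close>

lemma certificate_value_unique:
  assumes cert: "certificate A b \<C> a L" "certificate A b' \<C>' a L'" and "finite L"
    and meet: "\<And>C C'. C \<in> \<C> \<Longrightarrow> C' \<in> \<C>' \<Longrightarrow> C \<inter> C' \<noteq> {}"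
  shows "b = b'"
proof (rule ccontr)
  assume neq: "b \<noteq> b'"
  have step: "\<exists>v. h @ [v] \<in> L \<inter> L'" if h: "h \<in> L \<inter> L'" for h
  proof -
    have j: "justified A b \<C> a L h" and j': "justified A b' \<C>' a L' h"
      using cert h by (auto simp: certificate_def)
    from j show ?thesis
    proof (cases rule: justified_cases)
      case 1
      from j' show ?thesis by (cases rule: justified_cases) (use 1 neq in auto)
    next
      case (2 n C)
      from j' show ?thesis
      proof (cases rule: justified_cases)
        case (2 n' C')
        obtain v where "v \<in> C" "v \<in> C'" using meet[OF \<open>C \<in> \<C>\<close> \<open>C' \<in> \<C>'\<close>] by blast
        then show ?thesis using \<open>\<And>v. v \<in> C \<Longrightarrow> h @ [v] \<in> L\<close> 2(3) by blast
      next
        case (3 n')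
        then have "2 * n = 2 * n' + 1" using 2(1) by simp
        then show ?thesis by presburger
      qed (use 2(1) in simp)
    next
      case (3 n)
      from j' show ?thesis
      proof (cases rule: justified_cases)
        case (2 n' C')
        then have "2 * n' = 2 * n + 1" using 3(1) by simp
        then show ?thesis by presburger
      qed (use 3 in auto)
    qed
  qed
  have "finite (L \<inter> L')" "L \<inter> L' \<noteq> {}"
    using \<open>finite L\<close> cert by (auto simp: certificate_def)
  then have "Max (length ` (L \<inter> L')) \<in> length ` (L \<inter> L')" by (intro Max_in) auto
  then obtain h where h: "h \<in> L \<inter> L'" "length h = Max (length ` (L \<inter> L'))" by (metis imageE)
  from step[OF h(1)] obtain v where "h @ [v] \<in> L \<inter> L'" ..
  then have "length (h @ [v]) \<le> length h"
    unfolding h(2) using \<open>finite (L \<inter> L')\<close> by (intro Max_ge imageI finite_imageI)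
  then show False by simp
qed

text \<open>
  This is Koenig's lemma for the tree of plays in which Merlin is confined to finite subsets of
  Nimue's choices: if no finite set justifies a position and its continuations, the same holds for one
  of its finitely many successors, and an infinite play results.
\<close>

lemma ex_certificate:
  assumes win: "winning A N (basic_T3 omniscient_oracle) (basic_T3 B \<oplus> T0_T3 a)"
    and \<C>: "\<And>G. G \<in> B \<Longrightarrow> \<exists>C\<in>\<C>. finite C \<and> C \<subseteq> G"
  shows "\<exists>L. finite L \<and> certificate (A m) b \<C> a L"
proof -
  define g where "g = basic_T3 B \<oplus> T0_T3 a"
  have g_even: "g (2 * n) = B" and g_odd: "g (2 * n + 1) = {{a n}}" for n
    by (auto simp: g_def join_def basic_T3_def T0_T3_apply)
  have F: "{b} \<in> basic_T3 omniscient_oracle m" by (auto simp: basic_T3_def omniscient_oracle_def)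
  let ?reach = "reachable A N g m {b}"
  have move: "A m (map snd h) = Some (Declare b) \<or>
      (\<exists>n. A m (map snd h) = Some (Query n) \<and> N m {b} h n \<in> g n)" if "?reach h" for h
    using win F that unfolding winning_def g_def by blast
  have no_play: "\<not> (\<forall>k. ?reach (map p [0..<k]))" for p
    using win F unfolding winning_def g_def by blast
  define good where "good h \<longleftrightarrow> (\<exists>L. finite L \<and> h \<in> L \<and> (\<forall>h\<in>L. justified (A m) b \<C> a L h))" for h
  have good_ext: "good h" if "finite C"
    and good: "\<And>v. v \<in> C \<Longrightarrow> good (h @ [v])"
    and h: "A m h = Some (Declare b) \<or>
     (\<exists>n. A m h = Some (Query (2 * n))) \<and> C \<in> \<C> \<or>
     (\<exists>n. A m h = Some (Query (2 * n + 1)) \<and> C = {a n})" for h C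
  proof -
    have "\<forall>v\<in>C. \<exists>L. finite L \<and> h @ [v] \<in> L \<and> (\<forall>h\<in>L. justified (A m) b \<C> a L h)"
      using good unfolding good_def by blast
    from bchoice[OF this] obtain L where
      L: "\<And>v. v \<in> C \<Longrightarrow> finite (L v)" "\<And>v. v \<in> C \<Longrightarrow> h @ [v] \<in> L v"
        "\<And>v h'. v \<in> C \<Longrightarrow> h' \<in> L v \<Longrightarrow> justified (A m) b \<C> a (L v) h'"
      by blast
    let ?L = "insert h (\<Union>v\<in>C. L v)"
    have "justified (A m) b \<C> a ?L h'" if h': "h' \<in> ?L" for h'
    proof (cases "h' = h")
      case True
      have "\<forall>v\<in>C. h @ [v] \<in> ?L" using L(2) by blast
      then show ?thesis using h unfolding True justified_def by blast
    next
      case False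
      then obtain v where v: "v \<in> C" "h' \<in> L v" using h' by blast
      show ?thesis by (rule justified_mono[OF L(3)[OF v]]) (use v in blast)
    qed
    moreover have "finite ?L" using \<open>finite C\<close> L(1) by simp
    ultimately show ?thesis unfolding good_def by blast
  qed
  have extend: "\<exists>e. ?reach (h @ [e]) \<and> \<not> good (map snd (h @ [e]))"
    if reach: "?reach h" and bad: "\<not> good (map snd h)" for h
  proof -
    have "A m (map snd h) \<noteq> Some (Declare b)" using good_ext[of "{}" "map snd h"] bad by auto
    then obtain n where n: "A m (map snd h) = Some (Query n)" "N m {b} h n \<in> g n"
      using move[OF reach] by blast
    obtain C where C: "finite C" "C \<subseteq> N m {b} h n"
      "(\<exists>k. A m (map snd h) = Some (Query (2 * k))) \<and> C \<in> \<C> \<or>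
       (\<exists>k. A m (map snd h) = Some (Query (2 * k + 1)) \<and> C = {a k})"
    proof (cases "even n")
      case True
      then obtain k where k: "n = 2 * k" by blast
      then obtain C where "C \<in> \<C>" "finite C" "C \<subseteq> N m {b} h n"
        using \<C> n(2) g_even by metis
      then show ?thesis using that[of C] n(1) k by blast
    next
      case False
      then obtain k where k: "n = 2 * k + 1" using oddE by blast
      then show ?thesis using that[of "{a k}"] n g_odd by auto
    qed
    then obtain v where v: "v \<in> C" "\<not> good (map snd h @ [v])"
      using good_ext[of C "map snd h"] bad by blast
    have "?reach (h @ [(n, v)])"
      using reachable.round[OF reach n] v C by blast
    then show ?thesis using v by auto
  qed
  have "good []"
  proof (rule ccontr)
    assume "\<not> good []"
    define Bad where "Bad h \<longleftrightarrow> ?reach h \<and> \<not> good (map snd h)" for h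
    have "Bad []" using \<open>\<not> good []\<close> by (simp add: Bad_def reachable.start)
    moreover have "\<exists>h'. Bad h' \<and> (\<exists>e. h' = h @ [e])" if "Bad h" for h
      using extend that unfolding Bad_def by blast
    ultimately obtain H where H: "H 0 = []" "\<And>k. Bad (H k)" "\<And>k. \<exists>e. H (Suc k) = H k @ [e]"
      using dependent_nat_choice[of "\<lambda>k h. Bad h \<and> (k = 0 \<longrightarrow> h = [])" "\<lambda>_ h h'. \<exists>e. h' = h @ [e]"]
      by (metis (no_types, lifting) nat.distinct(1))
    then obtain p where "\<And>k. H (Suc k) = H k @ [p k]" by metis
    then have "map p [0..<k] = H k" for k using H(1) by (induction k) auto
    then show False using no_play H(2) Bad_def by metis
  qed
  then show ?thesis unfolding good_def certificate_def by blast
qed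


text \<open>
  The coded and bounded form of \<open>certificate\<close> for the family \<open>{{p, x}, {q, y}}\<close>: positions
  are coded as lists, \<open>c\<close> codes a finite set of them, \<open>l\<close> codes the known initial segment of
  \<open>a\<close>, whose length also serves as the stage at which \<open>R\<close> approximates the code of Arthur's
  move. The number \<open>m\<close> that Arthur sees at the start
  is always \<open>0\<close>, as every number is the start of a game for every value \<open>b\<close>.
\<close>

definition certificate_check ::
  "(nat list \<Rightarrow> nat) \<Rightarrow> nat \<Rightarrow> nat \<Rightarrow> nat \<Rightarrow> nat \<Rightarrow> nat \<Rightarrow> nat \<Rightarrow> nat \<Rightarrow> bool" where
  "certificate_check R b p q x y l c \<longleftrightarrow> 0 \<in> set_decode c \<and>
     (\<forall>h<c. h \<in> set_decode c \<longrightarrow>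
       R [code_length l, 0, h] = Suc (2 * b) \<or>
       (\<exists>n<R [code_length l, 0, h]. R [code_length l, 0, h] = Suc (2 * (2 * n) + 1)) \<and>
         (code_snoc h p \<in> set_decode c \<and> code_snoc h x \<in> set_decode c \<or>
          code_snoc h q \<in> set_decode c \<and> code_snoc h y \<in> set_decode c) \<or>
       (\<exists>n<code_length l. R [code_length l, 0, h] = Suc (2 * (2 * n + 1) + 1) \<and>
          code_snoc h (code_nth l n) \<in> set_decode c))"

lemma decidable_certificate_check:
  assumes "recursive 3 R" "recursive k x" "recursive k y" "recursive k l" "recursive k c"
  shows "decidable k (\<lambda>xs. certificate_check R b p q (x xs) (y xs) (l xs) (c xs))"
  unfolding certificate_check_def
  by (intro decidable_conj decidable_disj decidable_imp decidable_ball decidable_bex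
      decidable_mem_set_decode decidable_eq
      recursive_code_snoc recursive_code_nth recursive_code_length recursive_apply3[OF assms(1)]
      recursive_Suc recursive_add
      recursive_mult recursive_const recursive_hd recursive_tl[OF recursive_hd]
      recursive_tl[OF recursive_tl] recursive_tl assms(2-5))

text \<open>
  Hence the bound on positions in \<open>certificate_check\<close> omits none.
\<close>

lemma mem_set_decode_less: "h \<in> set_decode c \<Longrightarrow> h < c"
  unfolding set_decode_def
  by (metis div_less dual_order.strict_trans1 even_zero leI less_exp mem_Collect_eq)

context
  fixes r R A
  assumes R: "approximates 2 r R" and A: "computes_strategy r A"
begin

lemma stage_sound:
  assumes "R [s, m, h] = Suc (move_code d)"
  shows "A m (list_decode h) = Some d"
proof -
  have "rec_eval r [m, list_encode (list_decode h)] (move_code d)"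
    using approximates_sound[OF R _ assms] by simp
  then obtain d' where "A m (list_decode h) = Some d'" "move_code d' = move_code d"
    using A unfolding computes_strategy_def by metis
  then show ?thesis using move_code_eq_even move_code_eq_odd by (cases d) (simp_all only: move_code.simps)
qed

lemma stage_eventually:
  assumes "A m h = Some d"
  shows "\<forall>\<^sub>F s in sequentially. R [s, m, list_encode h] = Suc (move_code d)"
proof (rule approximates_eventually[OF R])
  show "rec_eval r [m, list_encode h] (move_code d)"
    using A assms unfolding computes_strategy_def by blast
qed simp

lemma certificate_check_sound:
  assumes check: "certificate_check R b p q x y (list_encode (map a [0..<k])) c"
  shows "certificate (A 0) b {{p, x}, {q, y}} a (list_decode ` set_decode c)"
    (is "certificate _ _ ?C _ ?L")
  unfolding certificate_def
proof (intro conjI ballI)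
  have "0 \<in> set_decode c" using check by (simp only: certificate_check_def)
  then show "[] \<in> ?L" by (intro image_eqI[of _ _ 0]) simp_all
  fix l assume "l \<in> ?L"
  then obtain h where h: "h \<in> set_decode c" "l = list_decode h" by blast
  have snoc: "l @ [v] \<in> ?L" if "code_snoc h v \<in> set_decode c" for v
    using that h(2) by (intro image_eqI[of _ _ "code_snoc h v"]) (simp_all add: code_snoc_def)
  have len: "code_length (list_encode (map a [0..<k])) = k" by (simp add: code_length_def)
  have nth: "code_nth (list_encode (map a [0..<k])) n = a n" if "n < k" for n
    using that by (simp add: code_nth_def len)
  from check h(1) consider
      "R [k, 0, h] = Suc (move_code (Declare b))"
    | n where "R [k, 0, h] = Suc (move_code (Query (2 * n)))"
      "code_snoc h p \<in> set_decode c \<and> code_snoc h x \<in> set_decode c \<or>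
       code_snoc h q \<in> set_decode c \<and> code_snoc h y \<in> set_decode c"
    | n where "R [k, 0, h] = Suc (move_code (Query (2 * n + 1)))" "code_snoc h (a n) \<in> set_decode c"
  proof -
    consider "R [k, 0, h] = Suc (2 * b)"
      | "\<exists>n<R [k, 0, h]. R [k, 0, h] = Suc (2 * (2 * n) + 1)"
        "code_snoc h p \<in> set_decode c \<and> code_snoc h x \<in> set_decode c \<or>
         code_snoc h q \<in> set_decode c \<and> code_snoc h y \<in> set_decode c"
      | n where "n < k" "R [k, 0, h] = Suc (2 * (2 * n + 1) + 1)"
        "code_snoc h (code_nth (list_encode (map a [0..<k])) n) \<in> set_decode c"
      using check h(1) mem_set_decode_less[OF h(1)] unfolding certificate_check_def len by blast
    then show ?thesis
    proof cases
      case 1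
      then show ?thesis using that(1) by simp
    next
      case 2
      then show ?thesis using that(2) by (metis move_code.simps(2))
    next
      case (3 n)
      then show ?thesis using that(3)[of n] nth[of n] by simp
    qed
  qed
  then show "justified (A 0) b ?C a ?L l"
  proof cases
    case 1
    then show ?thesis using stage_sound[OF 1] h(2) unfolding justified_def by blast
  next
    case 2
    have "\<exists>C\<in>?C. \<forall>v\<in>C. l @ [v] \<in> ?L" using 2(2) snoc by auto
    then show ?thesis using stage_sound[OF 2(1)] h(2) unfolding justified_def by blast
  next
    case 3
    then show ?thesis using stage_sound[OF 3(1)] h(2) snoc unfolding justified_def by blast
  qed
qed

text \<open>
  A certificate is finite, so some stage knows Arthur's move at all of its positions and the values
  of \<open>a\<close> that it uses.
\<close>

lemma certificate_check_eventually:
  assumes "finite L" and cert: "certificate (A 0) b {{p, x}, {q, y}} a L"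
  shows "\<forall>\<^sub>F k in sequentially. certificate_check R b p q x y (list_encode (map a [0..<k]))
    (set_encode (list_encode ` L))"
proof -
  let ?c = "set_encode (list_encode ` L)"
  have c: "set_decode ?c = list_encode ` L" using \<open>finite L\<close> by simp
  have snoc: "code_snoc (list_encode l) v \<in> set_decode ?c" if "l @ [v] \<in> L" for l v
    using that unfolding c code_snoc_def by simp
  have len: "code_length (list_encode (map a [0..<k])) = k" for k by (simp add: code_length_def)
  have nth: "code_nth (list_encode (map a [0..<k])) n = a n" if "n < k" for k n
    using that by (simp add: code_nth_def len)
  let ?ok = "\<lambda>k h. R [k, 0, h] = Suc (2 * b) \<or>
       (\<exists>n<R [k, 0, h]. R [k, 0, h] = Suc (2 * (2 * n) + 1)) \<and>
         (code_snoc h p \<in> set_decode ?c \<and> code_snoc h x \<in> set_decode ?c \<or>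
          code_snoc h q \<in> set_decode ?c \<and> code_snoc h y \<in> set_decode ?c) \<or>
       (\<exists>n<k. R [k, 0, h] = Suc (2 * (2 * n + 1) + 1) \<and>
          code_snoc h (code_nth (list_encode (map a [0..<k])) n) \<in> set_decode ?c)"
  have "\<forall>\<^sub>F k in sequentially. ?ok k (list_encode l)" if "l \<in> L" for l
  proof -
    consider "A 0 l = Some (Declare b)"
      | n C where "A 0 l = Some (Query (2 * n))" "C \<in> {{p, x}, {q, y}}" "\<And>v. v \<in> C \<Longrightarrow> l @ [v] \<in> L"
      | n where "A 0 l = Some (Query (2 * n + 1))" "l @ [a n] \<in> L"
      using cert \<open>l \<in> L\<close> justified_cases unfolding certificate_def by metis
    then show ?thesis
    proof cases
      case 1
      from stage_eventually[OF this] show ?thesis by eventually_elim simp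
    next
      case 2
      have "code_snoc (list_encode l) p \<in> set_decode ?c \<and> code_snoc (list_encode l) x \<in> set_decode ?c \<or>
          code_snoc (list_encode l) q \<in> set_decode ?c \<and> code_snoc (list_encode l) y \<in> set_decode ?c"
        using 2(2,3) snoc by blast
      moreover have "\<exists>n<t. t = Suc (2 * (2 * n) + 1)" if "t = Suc (move_code (Query (2 * n)))" for t n
        using that by (intro exI[of _ n]) simp
      ultimately show ?thesis
        using stage_eventually[OF 2(1)] by (rule_tac eventually_mono) blast+
    next
      case 3
      from stage_eventually[OF 3(1)] eventually_gt_at_top[of n] show ?thesis
      proof eventually_elim
        case (elim k)
        have "code_snoc (list_encode l) (code_nth (list_encode (map a [0..<k])) n) \<in> set_decode ?c"
          using snoc[OF 3(2)] nth[OF elim(2)] by simp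
        moreover have "R [k, 0, list_encode l] = Suc (2 * (2 * n + 1) + 1)" using elim(1) by simp
        ultimately show ?case using elim(2) by blast
      qed
    qed
  qed
  then have "\<forall>\<^sub>F k in sequentially. \<forall>l\<in>L. ?ok k (list_encode l)"
    using \<open>finite L\<close> by (intro eventually_ball_finite) blast+
  then show ?thesis
  proof eventually_elim
    case (elim k)
    have "0 \<in> set_decode ?c" unfolding c using cert by (force simp: certificate_def)
    moreover have "?ok k h" if "h \<in> set_decode ?c" for h
      using elim that unfolding c by blast
    ultimately show ?case unfolding certificate_check_def len by blast
  qed
qed

end

section \<open>From an omniscient coding oracle to the decoding oracle\<close>

lemma reachable_T0_queries_in_order:
  assumes "reachable A N (T0_T3 a) m F h"
    and "\<And>l n. A m l = Some (Query n) \<Longrightarrow> n = length l"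
  shows "map snd h = map a [0..<length h]"
  using assms(1)
proof induction
  case start
  then show ?case by simp
next
  case (round h n v)
  then show ?case using assms(2)[OF round.hyps(2)] by (simp add: T0_T3_apply)
qed

text \<open>
  The search for the two kinds of certificates, carried out as a game: the number of answers received
  so far bounds the codes of certificates, the stage of the approximation and the part of \<open>a\<close> used.
\<close>

lemma decoding_reducible_if_coding_omniscient:
  assumes pq: "p \<in> P" "q \<in> Q"
    and red: "basic_T3 omniscient_oracle \<preceq> basic_T3 (coding_oracle P Q) \<oplus> T0_T3 a"
  shows "T1_T3 (decoding_oracle (pair_set P Q) (pair_set Q P)) \<preceq> T0_T3 a"
proof -
  obtain A N where "computable_arthur A"
    and win: "winning A N (basic_T3 omniscient_oracle) (basic_T3 (coding_oracle P Q) \<oplus> T0_T3 a)"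
    using red by (auto simp: reducible_def)
  then obtain r where A: "computes_strategy r A" by (auto simp: computable_arthur_iff)
  obtain R where R: "approximates 2 r R" using ex_approximates by blast
  define found where "found b x y l \<longleftrightarrow> (\<exists>c<code_length l. certificate_check R b p q x y l c)"
    for b x y l
  have found_eventually: "\<forall>\<^sub>F k in sequentially. found b x y (list_encode (map a [0..<k]))"
    if "x \<in> P" "y \<in> Q" for b x y
  proof -
    have "\<exists>C\<in>{{p, x}, {q, y}}. finite C \<and> C \<subseteq> G" if "G \<in> coding_oracle P Q" for G
      using that \<open>x \<in> P\<close> \<open>y \<in> Q\<close> pq by (auto simp: coding_oracle_def)
    then obtain L where L: "finite L" "certificate (A 0) b {{p, x}, {q, y}} a L"
      using ex_certificate[OF win] by blast
    from certificate_check_eventually[OF R A L]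
      eventually_gt_at_top[of "set_encode (list_encode ` L)"] show ?thesis
    proof eventually_elim
      case (elim k)
      then show ?case unfolding found_def by (auto simp: code_length_def)
    qed
  qed
  have found_unique: "\<not> (found 0 x y (list_encode (map a [0..<k])) \<and>
      found 1 y x (list_encode (map a [0..<k'])))" for x y k k'
  proof
    assume "found 0 x y (list_encode (map a [0..<k])) \<and> found 1 y x (list_encode (map a [0..<k']))"
    then obtain c c' where "certificate (A 0) 0 {{p, x}, {q, y}} a (list_decode ` set_decode c)"
      "certificate (A 0) 1 {{p, y}, {q, x}} a (list_decode ` set_decode c')"
      unfolding found_def using certificate_check_sound[OF R A] by blast
    from certificate_value_unique[OF this] show False by auto
  qed
  let ?x = "\<lambda>m. fst (prod_decode m)" and ?y = "\<lambda>m. snd (prod_decode m)"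
  \<comment> \<open>The pair \<open>(y, x)\<close> lies in \<open>P \<times> Q\<close> when \<open>(x, y)\<close> lies in \<open>Q \<times> P\<close>, hence the exchanged arguments.\<close>
  define B where "B m l = (if found 0 (?x m) (?y m) (list_encode l) then Declare 0
      else if found 1 (?y m) (?x m) (list_encode l) then Declare 1 else Query (length l))" for m l
  \<comment> \<open>The move codes \<open>0\<close> and \<open>2\<close> stand for the declarations of \<open>0\<close> and \<open>1\<close>.\<close>
  define f where "f xs = (if found 0 (?x (xs ! 0)) (?y (xs ! 0)) (xs ! 1) then 0
      else if found 1 (?y (xs ! 0)) (?x (xs ! 0)) (xs ! 1) then 2
      else 2 * code_length (xs ! 1) + 1)" for xs
  have "recursive 3 R" using approximates_recursive[OF R] by (simp add: numeral_3_eq_3 numeral_2_eq_2)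
  then have "recursive 2 f" unfolding f_def found_def
    by (intro recursive_if decidable_bex decidable_certificate_check recursive_add recursive_mult
        recursive_code_length
        recursive_prod_decode recursive_const recursive_hd recursive_tl recursive_nth) auto
  then have comp: "computable_arthur (\<lambda>m l. Some (B m l))"
    by (rule computable_arthur_total) (simp add: f_def B_def code_length_def)
  have "winning (\<lambda>m l. Some (B m l)) (\<lambda>m F h n. {a n})
      (T1_T3 (decoding_oracle (pair_set P Q) (pair_set Q P))) (T0_T3 a)"
    unfolding winning_def
  proof (intro allI ballI)
    fix m F
    assume "F \<in> T1_T3 (decoding_oracle (pair_set P Q) (pair_set Q P)) m"
    then have m: "?x m \<in> P \<and> ?y m \<in> Q \<and> F = {0} \<or> ?y m \<in> P \<and> ?x m \<in> Q \<and> F = {1}"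
      by (auto simp: mem_T1_T3_decoding_oracle pair_set_def)
    let ?reach = "reachable (\<lambda>m l. Some (B m l)) (\<lambda>m F h n. {a n}) (T0_T3 a) m F"
    have answers: "map snd h = map a [0..<length h]" if "?reach h" for h
      by (rule reachable_T0_queries_in_order[OF that]) (auto simp: B_def split: if_splits)
    have ev: "\<forall>\<^sub>F k in sequentially. \<exists>u. B m (map a [0..<k]) = Declare u"
      using m
    proof (elim disjE conjE)
      assume "?x m \<in> P" "?y m \<in> Q"
      from found_eventually[OF this, of 0] show ?thesis by eventually_elim (simp add: B_def)
    next
      assume "?y m \<in> P" "?x m \<in> Q"
      from found_eventually[OF this, of 1] show ?thesis by eventually_elim (simp add: B_def)
    qed
    have right: "u \<in> F" if "B m (map a [0..<k]) = Declare u" for k u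
      using m
    proof (elim disjE conjE)
      assume "?x m \<in> P" "?y m \<in> Q" "F = {0}"
      then obtain k' where "found 0 (?x m) (?y m) (list_encode (map a [0..<k']))"
        using found_eventually eventually_happens'[OF sequentially_bot] by blast
      then show ?thesis using that found_unique \<open>F = {0}\<close> by (auto simp: B_def split: if_splits)
    next
      assume "?y m \<in> P" "?x m \<in> Q" "F = {1}"
      then obtain k' where "found 1 (?y m) (?x m) (list_encode (map a [0..<k']))"
        using found_eventually eventually_happens'[OF sequentially_bot] by blast
      then show ?thesis using that found_unique \<open>F = {1}\<close> by (auto simp: B_def split: if_splits)
    qed
    show "(\<forall>h. ?reach h \<longrightarrow>
          (\<exists>u\<in>F. Some (B m (map snd h)) = Some (Declare u)) \<or>
          (\<exists>n. Some (B m (map snd h)) = Some (Query n) \<and> {a n} \<in> T0_T3 a n)) \<and>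
        \<not> (\<exists>p. \<forall>k. ?reach (map p [0..<k]))"
    proof (intro conjI allI impI notI)
      fix h assume "?reach h"
      then show "(\<exists>u\<in>F. Some (B m (map snd h)) = Some (Declare u)) \<or>
          (\<exists>n. Some (B m (map snd h)) = Some (Query n) \<and> {a n} \<in> T0_T3 a n)"
        using answers right by (cases "B m (map snd h)") (auto simp: T0_T3_apply)
    next
      assume "\<exists>p. \<forall>k. ?reach (map p [0..<k])"
      then obtain p where p: "\<And>k. ?reach (map p [0..<k])" by blast
      obtain k u where k: "B m (map a [0..<k]) = Declare u"
        using eventually_happens'[OF sequentially_bot ev] by blast
      have "map snd (map p [0..<k]) = map a [0..<k]" using answers[OF p[of k]] by simp
      moreover have "\<exists>n. B m (map snd (map p [0..<k])) = Query n"
        using p[of "Suc k"] by (cases rule: reachable.cases) auto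
      ultimately show False using k by (metis arthur_move.distinct(1))
    qed
  qed
  then show ?thesis using comp by (auto simp: reducible_def)
qed

section \<open>Reductions between the remaining oracles\<close>

lemma rec_eval_Comp_total_iff:
  assumes "length ys = length ss" and "\<And>i. i < length ss \<Longrightarrow> rec_eval (ss ! i) xs (ys ! i)"
  shows "rec_eval (Comp r ss) xs z \<longleftrightarrow> rec_eval r ys z"
proof
  assume "rec_eval (Comp r ss) xs z"
  then obtain zs where zs: "list_all2 (\<lambda>s y. rec_eval s xs y) ss zs" "rec_eval r zs z"
    by (auto simp: rec_eval_Comp_iff)
  have "zs = ys"
  proof (rule nth_equalityI)
    show "length zs = length ys" using assms(1) zs(1) by (simp add: list_all2_lengthD)
    show "zs ! i = ys ! i" if "i < length zs" for i
      using assms(2)[of i] zs(1) that rec_eval_functional[of "ss ! i" xs "zs ! i" "ys ! i"]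
      by (auto simp: list_all2_conv_all_nth)
  qed
  then show "rec_eval r ys z" using zs(2) by simp
next
  assume "rec_eval r ys z"
  then show "rec_eval (Comp r ss) xs z"
    using assms by (intro rec_eval.Comp) (auto simp: list_all2_conv_all_nth)
qed

text \<open>
  New strategies arise from a given partial computable function by evaluating it once at
  recursively computed arguments \<open>es\<close> and turning its value into a move. They are undefined
  exactly where that evaluation is.
\<close>

lemma computable_arthur_postprocess:
  assumes r: "\<And>ys y. length ys = length es \<Longrightarrow> rec_eval r ys y \<longleftrightarrow> \<psi> ys = Some y"
    and es: "\<And>e. e \<in> set es \<Longrightarrow> recursive 2 e"
    and g: "recursive 3 g" "\<And>v m l. g [v, m, list_encode l] = move_code (B m l v)"
  shows "computable_arthur (\<lambda>m l. map_option (B m l) (\<psi> (map (\<lambda>e. e [m, list_encode l]) es)))"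
proof -
  obtain rg where "\<And>xs. length xs = 3 \<Longrightarrow> rec_eval rg xs (g xs)"
    using g(1) by (auto simp: recursive_def)
  then have rg: "rec_eval rg [v, m, c] (g [v, m, c])" for v m c by simp
  have "\<forall>e\<in>set es. \<exists>re. \<forall>xs. length xs = 2 \<longrightarrow> rec_eval re xs (e xs)"
    using es unfolding recursive_def by blast
  from bchoice[OF this] obtain E
    where E: "\<forall>e\<in>set es. \<forall>xs. length xs = 2 \<longrightarrow> rec_eval (E e) xs (e xs)" by blast
  let ?t = "Comp rg [Comp r (map E es), Proj 0, Proj 1]"
  have "rec_eval ?t [m, list_encode l] y \<longleftrightarrow>
      (\<exists>d. map_option (B m l) (\<psi> (map (\<lambda>e. e [m, list_encode l]) es)) = Some d \<and> y = move_code d)"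
    (is "_ \<longleftrightarrow> ?D") for m l y
  proof -
    let ?c = "list_encode l"
    have inner: "rec_eval (Comp r (map E es)) [m, ?c] v \<longleftrightarrow> \<psi> (map (\<lambda>e. e [m, ?c]) es) = Some v" for v
      by (subst rec_eval_Comp_total_iff[where ys = "map (\<lambda>e. e [m, ?c]) es"]) (use E r in auto)
    have "rec_eval ?t [m, ?c] y \<longleftrightarrow>
        (\<exists>v. \<psi> (map (\<lambda>e. e [m, ?c]) es) = Some v \<and> rec_eval rg [v, m, ?c] y)"
      unfolding rec_eval_Comp_iff[of rg] by (auto simp: list_all2_Cons1 inner rec_eval_Proj_iff)
    also have "\<dots> \<longleftrightarrow> ?D"
    proof -
      have "rec_eval rg [v, m, ?c] y \<longleftrightarrow> y = move_code (B m l v)" for v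
        using rg[of v m ?c] rec_eval_functional[of rg "[v, m, ?c]"] unfolding g(2) by blast
      then show ?thesis by auto
    qed
    finally show ?thesis .
  qed
  then show ?thesis unfolding computable_arthur_iff computes_strategy_def by blast
qed

text \<open>
  Through the omniscient oracle Nimue can hand Arthur any number, in particular an element of the set
  that he has to hit.
\<close>

lemma reducible_to_omniscient:
  assumes "{} \<notin> B"
  shows "basic_T3 B \<preceq> basic_T3 omniscient_oracle"
proof -
  define A where "A m l = (if l = [] then Query 0 else Declare (hd l))" for m :: nat and l
  have "recursive 2 (\<lambda>xs. if xs ! 1 = 0 then 1 else 2 * code_nth (xs ! 1) 0)"
    by (intro recursive_if decidable_zero recursive_mult recursive_code_nth recursive_const
        recursive_nth) auto
  then have comp: "computable_arthur (\<lambda>m l. Some (A m l))"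
  proof (rule computable_arthur_total)
    show "(if [m, list_encode l] ! 1 = 0 then 1 else 2 * code_nth ([m, list_encode l] ! 1) 0) =
        move_code (A m l)" for m l
      by (cases l) (auto simp: A_def code_nth_def code_length_def hd_conv_nth
          simp del: list_encode.simps(2), auto)
  qed
  have "winning (\<lambda>m l. Some (A m l)) (\<lambda>m F h n. {SOME v. v \<in> F}) (basic_T3 B)
      (basic_T3 omniscient_oracle)"
    unfolding winning_def
  proof (intro allI ballI conjI notI impI)
    fix m F assume "F \<in> basic_T3 B m"
    then have "F \<noteq> {}" using assms by (auto simp: basic_T3_def)
    then have F: "(SOME v. v \<in> F) \<in> F" by (simp add: some_in_eq)
    let ?reach = "reachable (\<lambda>m l. Some (A m l)) (\<lambda>m F h n. {SOME v. v \<in> F})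
      (basic_T3 omniscient_oracle) m F"
    have inv: "h = [] \<or> (\<exists>n. h = [(n, SOME v. v \<in> F)])" if "?reach h" for h
      using that by (induction rule: reachable.induct) (auto simp: A_def)
    {
      fix h assume "?reach h"
      from inv[OF this] show "(\<exists>u\<in>F. Some (A m (map snd h)) = Some (Declare u)) \<or>
        (\<exists>n. Some (A m (map snd h)) = Some (Query n) \<and>
          {SOME v. v \<in> F} \<in> basic_T3 omniscient_oracle n)"
        using F by (auto simp: A_def basic_T3_def omniscient_oracle_def)
    }
    assume "\<exists>p. \<forall>k. ?reach (map p [0..<k])"
    then obtain p where "?reach (map p [0..<2])" by blast
    from inv[OF this] show False by (auto simp: numeral_2_eq_2)
  qed
  then show ?thesis using comp by (auto simp: reducible_def)
qed

lemma zero_oracle_reducible: "T0_T3 zero_oracle \<preceq> g"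
proof -
  have comp: "computable_arthur (\<lambda>m l. Some (Declare 0))"
    using recursive_const[of 2 0] by (rule computable_arthur_total) simp
  have "winning (\<lambda>m l. Some (Declare 0)) N (T0_T3 zero_oracle) g" for N
    unfolding winning_def
  proof (intro allI ballI conjI notI impI)
    fix m F h assume "F \<in> T0_T3 zero_oracle m"
    then show "(\<exists>u\<in>F. Some (Declare 0) = Some (Declare u)) \<or>
      (\<exists>n. Some (Declare 0) = Some (Query n) \<and> N m F h n \<in> g n)"
      by (simp add: T0_T3_apply zero_oracle_def)
  next
    fix m F assume "\<exists>p. \<forall>k. reachable (\<lambda>m l. Some (Declare 0)) N g m F (map p [0..<k])"
    then obtain p where "reachable (\<lambda>m l. Some (Declare 0)) N g m F (map p [0..<1])" by blast
    then show False by (cases rule: reachable.cases) auto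
  qed
  then show ?thesis using comp by (auto simp: reducible_def)
qed

text \<open>
  Query \<open>n\<close> becomes query \<open>2 * n\<close>; Nimue's old strategy is applied to the history with all
  queries halved.
\<close>

lemma reducible_join_left:
  assumes "f \<preceq> g"
  shows "f \<preceq> g \<oplus> g'"
proof -
  obtain A N where "computable_arthur A" and win: "winning A N f g"
    using assms by (auto simp: reducible_def)
  then obtain r where r: "computes_strategy r A" by (auto simp: computable_arthur_iff)
  define dbl where "dbl d = (case d of Declare u \<Rightarrow> Declare u | Query n \<Rightarrow> Query (2 * n))" for d
  define A' where "A' m l = map_option dbl (A m l)" for m l
  define N' where "N' m F h n = N m F (map (\<lambda>(n, v). (n div 2, v)) h) (n div 2)" for m F h n
  \<comment> \<open>On move codes, doubling the query sends \<open>2 * n + 1\<close> to \<open>4 * n + 1\<close> and fixes even numbers.\<close>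
  define B where "B v = (if v mod 2 = 0 then Declare (v div 2) else Query (2 * (v div 2)))" for v
  have B: "B (move_code d) = dbl d" for d by (cases d) (auto simp: B_def dbl_def)
  define \<psi> where "\<psi> xs = map_option move_code (A (xs ! 0) (list_decode (xs ! 1)))" for xs
  have "computable_arthur (\<lambda>m l. map_option ((\<lambda>m l. B) m l)
      (\<psi> (map (\<lambda>e. e [m, list_encode l]) [\<lambda>xs. xs ! 0, \<lambda>xs. xs ! 1])))"
  proof (rule computable_arthur_postprocess)
    fix ys :: "nat list" and y assume "length ys = length [\<lambda>xs. xs ! 0, \<lambda>xs. xs ! (1::nat) :: nat]"
    then obtain m c where "ys = [m, c]" by (auto simp: length_Suc_conv)
    then show "rec_eval r ys y \<longleftrightarrow> \<psi> ys = Some y"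
      using r[unfolded computes_strategy_def, rule_format, of m "list_decode c" y]
      by (auto simp: \<psi>_def)
  next
    show "recursive 3 (\<lambda>xs. if xs ! 0 mod 2 = 0 then 2 * (xs ! 0 div 2) else 2 * (2 * (xs ! 0 div 2)) + 1)"
      by (intro recursive_if decidable_zero recursive_add recursive_mult recursive_div
          recursive_mod recursive_const recursive_nth) auto
  qed (auto simp: B_def intro: recursive_nth)
  then have comp: "computable_arthur A'"
    by (simp add: \<psi>_def A'_def[abs_def] B option.map_comp o_def)
  have "winning A' N' f (g \<oplus> g')"
    unfolding winning_def
  proof (intro allI ballI conjI notI impI)
    fix m F assume F: "F \<in> f m"
    let ?reach = "reachable A' N' (g \<oplus> g') m F" and ?halve = "map (\<lambda>(n, v). (n div 2 :: nat, v :: nat))"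
    have snd: "map snd (?halve h) = map snd h" for h by (induction h) auto
    have move: "\<exists>k. n = 2 * k \<and> A m l = Some (Query k)" if A': "A' m l = Some (Query n)" for n l
    proof -
      obtain d where "A m l = Some d" "dbl d = Query n" using A' by (auto simp: A'_def)
      then show ?thesis by (cases d) (auto simp: dbl_def)
    qed
    have halve: "reachable A N g m F (?halve h)" if "?reach h" for h
      using that
    proof induction
      case start
      show ?case by (simp add: reachable.start)
    next
      case (round h n v)
      obtain k where k: "n = 2 * k" "A m (map snd h) = Some (Query k)"
        using move[OF round.hyps(2)] by blast
      have "N m F (?halve h) k \<in> g k" "v \<in> N m F (?halve h) k"
        using round.hyps(3,4) k(1) by (auto simp: N'_def join_def)
      moreover have "A m (map snd (?halve h)) = Some (Query k)" using k(2) by (simp only: snd)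
      ultimately have "reachable A N g m F (?halve h @ [(k, v)])"
        using round.IH by (intro reachable.round)
      then show ?case using k(1) by simp
    qed
    {
      fix h assume "?reach h"
      from halve[OF this] have "(\<exists>u\<in>F. A m (map snd (?halve h)) = Some (Declare u)) \<or>
          (\<exists>n. A m (map snd (?halve h)) = Some (Query n) \<and> N m F (?halve h) n \<in> g n)"
        using win F unfolding winning_def by blast
      then show "(\<exists>u\<in>F. A' m (map snd h) = Some (Declare u)) \<or>
          (\<exists>n. A' m (map snd h) = Some (Query n) \<and> N' m F h n \<in> (g \<oplus> g') n)"
        unfolding snd
      proof (elim disjE exE conjE bexE)
        fix n assume "A m (map snd h) = Some (Query n)" "N m F (?halve h) n \<in> g n"
        then show ?thesis
          by (intro disjI2 exI[of _ "2 * n"]) (simp add: A'_def dbl_def N'_def join_def)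
      qed (auto simp: A'_def dbl_def)
    }
    assume "\<exists>p. \<forall>k. ?reach (map p [0..<k])"
    then obtain p where p: "\<And>k. ?reach (map p [0..<k])" by blast
    have "reachable A N g m F (map ((\<lambda>(n, v). (n div 2, v)) \<circ> p) [0..<k])" for k
      using halve[OF p[of k]] by (simp only: map_map)
    then show False using win F unfolding winning_def by blast
  qed
  then show ?thesis using comp by (auto simp: reducible_def)
qed

text \<open>
  Every legal answer in the game to the zero oracle is \<open>0\<close>, so Arthur's play can be
  simulated without an oracle: search for the least number of answers after which he makes a declaration.
\<close>

lemma promise_decidable_if_reducible_zero:
  assumes disj: "P \<inter> Q = {}"
    and red: "T1_T3 (decoding_oracle P Q) \<preceq> T0_T3 zero_oracle"
  shows "promise_decidable P Q"
proof -
  obtain A N where "computable_arthur A"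
    and win: "winning A N (T1_T3 (decoding_oracle P Q)) (T0_T3 zero_oracle)"
    using red by (auto simp: reducible_def)
  then obtain r where r: "computes_strategy r A" by (auto simp: computable_arthur_iff)
  have play: "\<exists>k. \<exists>u\<in>F. A m (replicate k 0) = Some (Declare u) \<and>
      (\<forall>i<k. \<exists>n. A m (replicate i 0) = Some (Query n))"
    if F: "F \<in> T1_T3 (decoding_oracle P Q) m" for m F
  proof -
    define p where "p i = ((SOME n. A m (replicate i 0) = Some (Query n)), 0 :: nat)" for i
    let ?reach = "reachable A N (T0_T3 zero_oracle) m F"
    let ?decl = "\<lambda>i. \<exists>u. A m (replicate i 0) = Some (Declare u)"
    have snd: "map snd (map p [0..<k]) = replicate k 0" for k
      by (simp add: p_def o_def map_replicate_const)
    have move: "(\<exists>u\<in>F. A m (replicate k 0) = Some (Declare u)) \<or>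
        (\<exists>n. A m (replicate k 0) = Some (Query n) \<and> N m F (map p [0..<k]) n = {0})"
      if "?reach (map p [0..<k])" for k
    proof -
      have "(\<exists>u\<in>F. A m (map snd (map p [0..<k])) = Some (Declare u)) \<or>
          (\<exists>n. A m (map snd (map p [0..<k])) = Some (Query n) \<and>
            N m F (map p [0..<k]) n \<in> T0_T3 zero_oracle n)"
        using win F that unfolding winning_def by blast
      then show ?thesis unfolding snd by (simp add: T0_T3_apply zero_oracle_def)
    qed
    have reach: "?reach (map p [0..<k])" if "\<forall>i<k. \<not> ?decl i" for k
      using that
    proof (induction k)
      case 0
      show ?case by (simp add: reachable.start)
    next
      case (Suc k)
      then have IH: "?reach (map p [0..<k])" and "\<not> ?decl k" by auto
      then obtain n where n: "A m (replicate k 0) = Some (Query n)" "N m F (map p [0..<k]) n = {0}"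
        using move by blast
      have "p k = (n, 0)" using n(1) by (simp add: p_def)
      moreover have "?reach (map p [0..<k] @ [(n, 0)])"
        by (rule reachable.round[OF IH]) (use n snd in \<open>auto simp: T0_T3_apply zero_oracle_def\<close>)
      ultimately show ?case by simp
    qed
    have "\<exists>k. ?decl k"
      using reach win F unfolding winning_def by blast
    then obtain k where k: "?decl k" "\<forall>i<k. \<not> ?decl i"
      using exists_least_iff[of ?decl] by blast
    have "\<exists>n. A m (replicate i 0) = Some (Query n)" if "i < k" for i
      using move[OF reach[of i]] k(2) that by (meson less_trans)
    moreover have "\<exists>u\<in>F. A m (replicate k 0) = Some (Declare u)"
      using move[OF reach[OF k(2)]] k(1) by auto
    ultimately show ?thesis by blast
  qed
  have zeros: "rec_nat 0 (\<lambda>_ c. code_snoc c 0) k = list_encode (replicate k 0)" for k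
    by (induction k) (simp_all add: code_snoc_def replicate_append_same)
  have "recursive 1 (\<lambda>xs. rec_nat 0 (\<lambda>_ c. code_snoc c 0) (xs ! 0))"
    by (intro recursive_rec_nat recursive_code_snoc recursive_const recursive_nth
        recursive_tl[OF recursive_hd]) simp
  then obtain rz where rz': "\<And>xs. length xs = 1 \<Longrightarrow> rec_eval rz xs (list_encode (replicate (xs ! 0) 0))"
    unfolding recursive_def zeros by blast
  have rz: "rec_eval rz [k] (list_encode (replicate k 0))" for k using rz'[of "[k]"] by simp
  obtain rm where rm': "\<And>xs. length xs = 1 \<Longrightarrow> rec_eval rm xs (xs ! 0 mod 2)"
    using recursive_mod[OF recursive_nth[of 0 1] recursive_const[of 1 2]] unfolding recursive_def by auto
  have rm: "rec_eval rm [k] (k mod 2)" for k using rm'[of "[k]"] by simp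
  obtain rd where rd': "\<And>xs. length xs = 1 \<Longrightarrow> rec_eval rd xs (xs ! 0 div 2)"
    using recursive_div[OF recursive_nth[of 0 1] recursive_const[of 1 2]] unfolding recursive_def by auto
  have rd: "rec_eval rd [k] (k div 2)" for k using rd'[of "[k]"] by simp
  \<comment> \<open>Even move codes are declarations, so \<open>Mu r1\<close> is the number of queries that precede the declaration,
    and halving the code of the declaration yields the declared value.\<close>
  define r1 where "r1 = Comp rm [Comp r [Proj 1, Comp rz [Proj 0]]]"
  define t where "t = Comp rd [Comp r [Proj 0, Comp rz [Mu r1]]]"
  have r_eval: "rec_eval r [m, list_encode l] (move_code d)" if "A m l = Some d" for m l d
    using r that unfolding computes_strategy_def by blast
  have r1: "rec_eval r1 [i, m] (move_code d mod 2)" if "A m (replicate i 0) = Some d" for i m d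
  proof -
    have "rec_eval (Comp rz [Proj 0]) [i, m] (list_encode (replicate i 0))"
      using rz by (intro rec_eval.Comp[of _ _ "[i]"]) (auto simp: rec_eval_Proj_iff)
    then have "rec_eval (Comp r [Proj 1, Comp rz [Proj 0]]) [i, m] (move_code d)"
      using r_eval[OF that]
      by (intro rec_eval.Comp[of _ _ "[m, list_encode (replicate i 0)]"]) (auto simp: rec_eval_Proj_iff)
    then show ?thesis
      unfolding r1_def using rm by (intro rec_eval.Comp[of _ _ "[move_code d]"]) auto
  qed
  have t: "rec_eval t [m] u" if k: "A m (replicate k 0) = Some (Declare u)"
    and queries: "\<forall>i<k. \<exists>n. A m (replicate i 0) = Some (Query n)" for m k u
  proof -
    have mu: "rec_eval (Mu r1) [m] k"
    proof (rule rec_eval.Mu)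
      show "rec_eval r1 [k, m] 0" using r1[OF k] by simp
      show "\<forall>i<k. \<exists>y. rec_eval r1 [i, m] (Suc y)"
      proof (intro allI impI)
        fix i assume "i < k"
        then obtain n where "A m (replicate i 0) = Some (Query n)" using queries by blast
        from r1[OF this] show "\<exists>y. rec_eval r1 [i, m] (Suc y)" by auto
      qed
    qed
    have "rec_eval (Comp rz [Mu r1]) [m] (list_encode (replicate k 0))"
      using mu rz by (intro rec_eval.Comp[of _ _ "[k]"]) auto
    then have "rec_eval (Comp r [Proj 0, Comp rz [Mu r1]]) [m] (2 * u)"
      using r_eval[OF k]
      by (intro rec_eval.Comp[of _ _ "[m, list_encode (replicate k 0)]"]) (auto simp: rec_eval_Proj_iff)
    then show ?thesis
      unfolding t_def using rd[of "2 * u"] by (intro rec_eval.Comp[of _ _ "[2 * u]"]) auto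
  qed
  define \<phi> where "\<phi> n = (if \<exists>y. rec_eval t [n] y then Some (THE y. rec_eval t [n] y) else None)" for n
  have \<phi>: "\<phi> n = Some y \<longleftrightarrow> rec_eval t [n] y" for n y
    unfolding \<phi>_def using rec_eval_functional[of t "[n]"] by (auto intro: theI2)
  show ?thesis unfolding promise_decidable_def
  proof (intro exI conjI ballI)
    show "partial_computable 1 (\<lambda>xs. \<phi> (xs ! 0))"
      unfolding partial_computable_def
    proof (intro exI allI impI)
      fix xs :: "nat list" and y assume "length xs = 1"
      then show "\<phi> (xs ! 0) = Some y \<longleftrightarrow> rec_eval t xs y" by (auto simp: \<phi> length_Suc_conv)
    qed
    show "\<phi> n = Some 0" if "n \<in> P" for n
      using play[of "{0}" n] t that by (auto simp: mem_T1_T3_decoding_oracle \<phi>)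
    show "\<phi> n = Some 1" if "n \<in> Q" for n
      using play[of "{1}" n] t that disj by (auto simp: mem_T1_T3_decoding_oracle \<phi>)
  qed
qed

text \<open>
  Nimue sends the number \<open>K\<close> in unary: in each of the first \<open>K\<close> pairs of rounds she chooses \<open>P\<close> and
  then \<open>Q\<close>, in the next pair \<open>Q\<close> and then \<open>P\<close>. After every pair of rounds Arthur applies the decision procedure
  to Merlin's two answers and declares the number of earlier pairs once the order is reversed.
\<close>

lemma coding_omniscient_if_promise_decidable:
  assumes pq: "p \<in> P" "q \<in> Q"
    and dec: "promise_decidable (pair_set P Q) (pair_set Q P)"
  shows "basic_T3 omniscient_oracle \<preceq> basic_T3 (coding_oracle P Q)"
proof -
  obtain \<phi> where comp\<phi>: "partial_computable 1 (\<lambda>xs. \<phi> (xs ! 0))"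
    and \<phi>0: "\<forall>n\<in>pair_set P Q. \<phi> n = Some 0" and \<phi>1: "\<forall>n\<in>pair_set Q P. \<phi> n = Some 1"
    using dec unfolding promise_decidable_def by blast
  obtain r where r: "\<And>xs y. length xs = 1 \<Longrightarrow> \<phi> (xs ! 0) = Some y \<longleftrightarrow> rec_eval r xs y"
    using comp\<phi> unfolding partial_computable_def by blast
  have \<phi>PQ: "\<phi> (prod_encode (x, y)) = Some 0" if "x \<in> P" "y \<in> Q" for x y
    using \<phi>0 that by (auto simp: pair_set_def)
  have \<phi>QP: "\<phi> (prod_encode (x, y)) = Some 1" if "x \<in> Q" "y \<in> P" for x y
    using \<phi>1 that by (auto simp: pair_set_def)
  \<comment> \<open>The decision procedure may diverge outside of its promise. While no complete pair has just been
    received it is run on \<open>(p, q)\<close>, where its value \<open>0\<close> makes Arthur continue.\<close>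
  define e where "e l = (if length l \<noteq> 0 \<and> even (length l)
      then prod_encode (l ! (length l - 2), l ! (length l - 1)) else prod_encode (p, q))" for l
  define B where "B l v = (if v = 1 then Declare (length l div 2 - 1) else Query 0)" for l :: "nat list" and v :: nat
  define A where "A m l = map_option (B l) (\<phi> (e l))" for m :: nat and l
  define ec where "ec xs = (if code_length (xs ! 1) \<noteq> 0 \<and> code_length (xs ! 1) mod 2 = 0
      then prod_encode (code_nth (xs ! 1) (code_length (xs ! 1) - 2),
        code_nth (xs ! 1) (code_length (xs ! 1) - 1)) else prod_encode (p, q))" for xs
  have ec: "ec [m, list_encode l] = e l" for m l
    by (auto simp: ec_def e_def code_length_def code_nth_def)
  have "recursive 2 ec" unfolding ec_def
    by (intro recursive_if decidable_conj decidable_not decidable_eq recursive_prod_encode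
        recursive_code_nth recursive_diff recursive_mod
        recursive_code_length recursive_const recursive_nth) auto
  moreover have "recursive 3 (\<lambda>xs. if xs ! 0 = 1 then 2 * (code_length (xs ! 2) div 2 - 1) else 1)"
    by (intro recursive_if decidable_eq recursive_mult recursive_diff recursive_div
        recursive_code_length recursive_const recursive_nth) auto
  ultimately have "computable_arthur (\<lambda>m l. map_option ((\<lambda>m l. B l) m l)
      ((\<lambda>xs. \<phi> (xs ! 0)) (map (\<lambda>f. f [m, list_encode l]) [ec])))"
    by (rule_tac r = r in computable_arthur_postprocess)
      (auto simp: r B_def code_length_def)
  then have comp: "computable_arthur A" by (simp add: A_def[abs_def] ec)
  define N where "N m F h n = (if (length h div 2 < the_elem F) = even (length h) then P else Q)"
    for m :: nat and F :: "nat set" and h :: "(nat \<times> nat) list" and n :: nat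
  have "winning A N (basic_T3 omniscient_oracle) (basic_T3 (coding_oracle P Q))"
    unfolding winning_def
  proof (intro allI ballI conjI notI impI)
    fix m F assume "F \<in> basic_T3 omniscient_oracle m"
    then obtain K where F: "F = {K}" by (auto simp: basic_T3_def omniscient_oracle_def)
    let ?reach = "reachable A N (basic_T3 (coding_oracle P Q)) m F"
    let ?S = "\<lambda>i. if (i div 2 < K) = even i then P else Q"
    let ?inv = "\<lambda>h. length h \<le> 2 * K + 2 \<and> (\<forall>i<length h. snd (h ! i) \<in> ?S i)"
    have move: "A m (map snd h) = Some (if length h = 2 * K + 2 then Declare K else Query 0)"
      if inv: "?inv h" for h :: "(nat \<times> nat) list"
    proof (cases "length h \<noteq> 0 \<and> even (length h)")
      case False
      then have "e (map snd h) = prod_encode (p, q)" by (auto simp: e_def)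
      moreover have "length h \<noteq> 2 * K + 2" using False by auto
      ultimately show ?thesis using \<phi>PQ[OF pq] by (simp add: A_def B_def)
    next
      case True
      then obtain j where j: "length h = 2 * j + 2"
        by (metis add.commute add_2_eq_Suc dvdE mult_Suc_right not0_implies_Suc mult_0_right)
      have e: "e (map snd h) = prod_encode (snd (h ! (2 * j)), snd (h ! (2 * j + 1)))"
        using j by (simp add: e_def)
      have mem: "snd (h ! (2 * j)) \<in> (if j < K then P else Q)"
        "snd (h ! (2 * j + 1)) \<in> (if j < K then Q else P)"
        using inv[THEN conjunct2, rule_format, of "2 * j"]
          inv[THEN conjunct2, rule_format, of "2 * j + 1"] j by auto
      have "j \<le> K" using inv j by simp
      show ?thesis
      proof (cases "j < K")
        case True
        then have "\<phi> (e (map snd h)) = Some 0" unfolding e using mem by (intro \<phi>PQ) auto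
        then show ?thesis using True j by (simp add: A_def B_def)
      next
        case False
        then have "\<phi> (e (map snd h)) = Some 1" unfolding e using mem by (intro \<phi>QP) auto
        then show ?thesis using False j \<open>j \<le> K\<close> by (simp add: A_def B_def)
      qed
    qed
    have inv: "?inv h" if "?reach h" for h
      using that
    proof induction
      case start
      show ?case by simp
    next
      case (round h n v)
      have "length h \<noteq> 2 * K + 2" using move[OF round.IH] round.hyps(2) by auto
      moreover have "v \<in> ?S (length h)" using round.hyps(4) by (simp add: N_def F)
      ultimately show ?case using round.IH by (auto simp: nth_append less_Suc_eq)
    qed
    {
      fix h assume "?reach h"
      from move[OF inv[OF this]] show "(\<exists>u\<in>F. A m (map snd h) = Some (Declare u)) \<or>
          (\<exists>n. A m (map snd h) = Some (Query n) \<and> N m F h n \<in> basic_T3 (coding_oracle P Q) n)"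
        by (auto simp: F N_def basic_T3_def coding_oracle_def)
    }
    assume "\<exists>p. \<forall>k. ?reach (map p [0..<k])"
    then obtain p where "?reach (map p [0..<2 * K + 3])" by blast
    from inv[OF this] show False by simp
  qed
  then show ?thesis using comp by (auto simp: reducible_def)
qed

theorem theorem4p17:
  fixes P Q :: "nat set"
  assumes "P \<noteq> {}" and "Q \<noteq> {}" and "P \<inter> Q = {}"
  shows
    "(basic_T3 (coding_oracle P Q) \<approx> basic_T3 omniscient_oracle \<longleftrightarrow>
        promise_decidable (pair_set P Q) (pair_set Q P)) \<and>
     (basic_T3 (coding_oracle P Q) \<approx> basic_T3 omniscient_oracle \<longleftrightarrow>
        T1_T3 (decoding_oracle (pair_set P Q) (pair_set Q P)) \<approx> T0_T3 zero_oracle) \<and>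
     (\<forall>a :: oracle0.
        basic_T3 (coding_oracle P Q) \<oplus> T0_T3 a \<approx> basic_T3 omniscient_oracle \<longrightarrow>
        T1_T3 (decoding_oracle (pair_set P Q) (pair_set Q P)) \<preceq> T0_T3 a)"
proof -
  obtain p q where pq: "p \<in> P" "q \<in> Q" using assms(1,2) by blast
  let ?c = "basic_T3 (coding_oracle P Q)" and ?w = "basic_T3 omniscient_oracle"
  let ?d = "T1_T3 (decoding_oracle (pair_set P Q) (pair_set Q P))"
  have "pair_set P Q \<inter> pair_set Q P = {}" using assms(3) by (auto simp: pair_set_def)
  then have decidable: "promise_decidable (pair_set P Q) (pair_set Q P)" if "?d \<preceq> T0_T3 zero_oracle"
    using promise_decidable_if_reducible_zero that by blast
  have relative: "?d \<preceq> T0_T3 a" if "?w \<preceq> ?c \<oplus> T0_T3 a" for a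
    using decoding_reducible_if_coding_omniscient[OF pq that] .
  have plain: "?d \<preceq> T0_T3 zero_oracle" if "?w \<preceq> ?c"
    using relative[OF reducible_join_left[OF that]] .
  have omniscient: "?w \<preceq> ?c" if "promise_decidable (pair_set P Q) (pair_set Q P)"
    using coding_omniscient_if_promise_decidable[OF pq that] .
  have "{} \<notin> coding_oracle P Q" using assms(1,2) by (auto simp: coding_oracle_def)
  then have "?c \<preceq> ?w" by (rule reducible_to_omniscient)
  then show ?thesis
    using decidable relative plain omniscient zero_oracle_reducible
    unfolding same_degree_def by blast
qed

end
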